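(* Let $\alpha : [0,+\infty) \to [1,+\infty)$ be a continuous and nondecreasing function. Let $X := \mathcal{C}([0,+\infty)) \cap L^1([0,+\infty))$ with the metric $$d_X(f,g) := \|f-g\|_{L^1} + \sum_{n=1}^{\infty} \frac{1}{2^n}\cdot \frac{\|f-g\|_{\infty,n}}{1+\|f-g\|_{\infty,n}},\qquad \|f\|_{\infty,n} = \max\{|f(x)| : x\in[0,n]\},$$ and let $c_0(X) := \{(f_n)_n : f_n\in X \text{ for all } n\in\mathbb{N} \text{ and } d_X(f_n,0)\to 0 \text{ as } n\to\infty\}$, endowed with the metric $d_{c_0(X)}((f_n)_n,(g_n)_n)=\sup_{n\in\mathbb{N}} d_X(f_n,g_n)$. Let $\mathcal{A}_0(\alpha)$ be the family of sequences $(f_n)_n$ of functions in $X$ with growth $\alpha$ such that $f_n\to 0$ in $L^1$-norm and almost uniformly in $[0,+\infty)$. Then $\mathcal{A}_0(\alpha)$ is maximal dense-lineable and strongly algebrable; that is: (i) there is a vector subspace $M\subset c_0(X)$, dense in $(c_0(X),d_{c_0(X)})$, with $\dim(M)=\dim(c_0(X))$ and $M\setminus\{0\}\subset\mathcal{A}_0(\alpha)$; and (ii) there is an infinitely generated free (commutative) subalgebra $N$ of the algebra $\mathcal{C}([0,+\infty))^{\mathbb{N}}$ of sequences of continuous functions (with componentwise pointwise operations) such that $N\setminus\{0\}\subset\mathcal{A}_0(\alpha)$.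
   Context: $\mathcal{C}([0,+\infty))$ is the real algebra of all continuous functions $[0,+\infty)\to\mathbb{R}$ with pointwise operations, and $L^1([0,+\infty))$ is the space of Lebesgue integrable functions on $[0,+\infty)$ with $\|f\|_{L^1}=\int_0^\infty |f(x)|\,dx$. A function $f\in\mathcal{C}([0,+\infty))$ has growth $\alpha$ if $\limsup_{x\to+\infty}|f(x)|/\alpha(x)=+\infty$. A sequence $f_n\to f$ almost uniformly on $[0,+\infty)$ if for every $\varepsilon>0$ there is a (measurable) set $E\subset[0,+\infty)$ with $m(E)\le\varepsilon$ such that $f_n\to f$ uniformly on $[0,+\infty)\setminus E$, where $m$ is Lebesgue measure. Vector space operations on sequences are componentwise. Dimension means algebraic (Hamel) dimension over $\mathbb{R}$. Dense-lineability asks for a dense vector subspace whose nonzero elements lie in the given set; it is maximal if that subspace has the dimension of the whole ambient space. Subalgebras are not required to contain a unit. A subset $A$ of a commutative algebra is strongly algebrable if there is a free algebra $N$ with $N\setminus\{0\}\subset A$ that is infinitely generated (every system of generators is infinite). Equivalently, there is an infinite set $B$ generating the algebra $N$ such that for every $s\in\mathbb{N}$, every nonzero polynomial $P$ in $s$ variables without constant term and all distinct $f_1,\dots,f_s\in B$, one has $P(f_1,\dots,f_s)\in N\setminus\{0\}$, and $N\setminus\{0\}\subset A$. *)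

theory Defs
  imports
    "HOL-Analysis.Analysis"
    "HOL-Library.Function_Algebras"
    "HOL-Library.Poly_Mapping"
    "HOL-Library.Equipollence"
begin

text \<open>
  Pointwise scalar multiplication, complementing the pointwise ring operations of
  \<^theory>\<open>HOL-Library.Function_Algebras\<close>.  Applied twice, it turns
  \<^typ>\<open>nat \<Rightarrow> real \<Rightarrow> real\<close> into a commutative real algebra with componentwise pointwise
  operations.
\<close>

instantiation "fun" :: (type, scaleR) scaleR
begin

definition "c *\<^sub>R f = (\<lambda>x. c *\<^sub>R f x)"

instance ..

end

lemma scaleR_fun_apply [simp]: "(c *\<^sub>R f) x = c *\<^sub>R f x"
  by (simp add: scaleR_fun_def)

instance "fun" :: (type, real_vector) real_vector
  by standard (simp_all add: fun_eq_iff scaleR_add_right scaleR_add_left)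

instance "fun" :: (type, real_algebra) real_algebra
  by standard (simp_all add: fun_eq_iff)

instance "fun" :: (type, real_algebra_1) real_algebra_1 ..


text \<open>
  A function on \<open>[0,\<infinity>)\<close> is represented by its extension by \<open>0\<close> to the whole line, so that
  equality, the algebraic operations and linear independence are those of functions on
  \<open>[0,\<infinity>)\<close>.  Continuity is required on \<open>[0,\<infinity>)\<close> only; the extension may jump at \<open>0\<close>.
\<close>

definition C_halfline :: "(real \<Rightarrow> real) set" where
  "C_halfline = {f. continuous_on {0..} f \<and> (\<forall>x<0. f x = 0)}"

definition X_space :: "(real \<Rightarrow> real) set" where
  "X_space = {f \<in> C_halfline. f absolutely_integrable_on {0..}}"

definition L1_norm :: "(real \<Rightarrow> real) \<Rightarrow> real" where
  "L1_norm f = (LINT x:{0..}|lebesgue. \<bar>f x\<bar>)"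

definition sup_norm :: "nat \<Rightarrow> (real \<Rightarrow> real) \<Rightarrow> real" where
  "sup_norm n f = (SUP x\<in>{0..real n}. \<bar>f x\<bar>)"

definition d_X :: "(real \<Rightarrow> real) \<Rightarrow> (real \<Rightarrow> real) \<Rightarrow> real" where
  "d_X f g = L1_norm (f - g) +
     suminf (\<lambda>k. let n = Suc k in
       1 / 2 ^ n * (sup_norm n (f - g) / (1 + sup_norm n (f - g))))"

definition c0_X :: "(nat \<Rightarrow> real \<Rightarrow> real) set" where
  "c0_X = {F. (\<forall>n. F n \<in> X_space) \<and> (\<lambda>n. d_X (F n) 0) \<longlonglongrightarrow> 0}"

definition d_c0 :: "(nat \<Rightarrow> real \<Rightarrow> real) \<Rightarrow> (nat \<Rightarrow> real \<Rightarrow> real) \<Rightarrow> real" where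
  "d_c0 F G = (SUP n. d_X (F n) (G n))"


definition has_growth :: "(real \<Rightarrow> real) \<Rightarrow> (real \<Rightarrow> real) \<Rightarrow> bool" where
  "has_growth \<alpha> f \<longleftrightarrow> Limsup at_top (\<lambda>x. ereal (\<bar>f x\<bar> / \<alpha> x)) = \<infinity>"

definition almost_uniform_limit :: "(nat \<Rightarrow> real \<Rightarrow> real) \<Rightarrow> (real \<Rightarrow> real) \<Rightarrow> bool" where
  "almost_uniform_limit F f \<longleftrightarrow>
     (\<forall>\<epsilon>>0. \<exists>E. E \<in> sets lebesgue \<and> E \<subseteq> {0..} \<and> emeasure lebesgue E \<le> ennreal \<epsilon> \<and>
        uniform_limit ({0..} - E) F f sequentially)"

definition A0 :: "(real \<Rightarrow> real) \<Rightarrow> (nat \<Rightarrow> real \<Rightarrow> real) set" where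
  "A0 \<alpha> = {F. (\<forall>n. F n \<in> X_space \<and> has_growth \<alpha> (F n)) \<and>
              (\<lambda>n. L1_norm (F n)) \<longlonglongrightarrow> 0 \<and> almost_uniform_limit F 0}"


text \<open>
  Equality of Hamel dimensions as cardinals; \<^const>\<open>dim\<close> is a natural number and does not
  distinguish infinite dimensions.
\<close>

definition same_dimension :: "'a::real_vector set \<Rightarrow> 'b::real_vector set \<Rightarrow> bool" where
  "same_dimension V W \<longleftrightarrow>
     (\<exists>B C. independent B \<and> span B = V \<and> independent C \<and> span C = W \<and> B \<approx> C)"


definition subalgebra :: "'a::real_algebra set \<Rightarrow> bool" where
  "subalgebra N \<longleftrightarrow> subspace N \<and> (\<forall>f\<in>N. \<forall>g\<in>N. f * g \<in> N)"

text \<open>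
  A real polynomial in the variables with indices below \<open>s\<close> is a finitely supported family of
  coefficients indexed by monomials, a monomial being a finitely supported family of exponents.
\<close>

type_synonym mpolynomial = "(nat \<Rightarrow>\<^sub>0 nat) \<Rightarrow>\<^sub>0 real"

definition polynomials_without_constant_term :: "nat \<Rightarrow> mpolynomial set" where
  "polynomials_without_constant_term s =
     {P. (\<forall>m\<in>Poly_Mapping.keys P. Poly_Mapping.keys m \<subseteq> {..<s}) \<and> Poly_Mapping.lookup P 0 = 0}"

definition evaluate :: "mpolynomial \<Rightarrow> (nat \<Rightarrow> 'a) \<Rightarrow> 'a::{real_algebra_1,comm_ring_1}" where
  "evaluate P f = (\<Sum>m\<in>Poly_Mapping.keys P.
     Poly_Mapping.lookup P m *\<^sub>R (\<Prod>i\<in>Poly_Mapping.keys m. f i ^ Poly_Mapping.lookup m i))"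

definition freely_generates :: "'a::{real_algebra_1,comm_ring_1} set \<Rightarrow> 'a set \<Rightarrow> bool" where
  "freely_generates B N \<longleftrightarrow>
     subalgebra hull B = N \<and>
     (\<forall>s f. \<forall>P\<in>polynomials_without_constant_term s.
        P \<noteq> 0 \<and> inj_on f {..<s} \<and> f ` {..<s} \<subseteq> B \<longrightarrow> evaluate P f \<in> N - {0})"

definition free_algebra :: "'a::{real_algebra_1,comm_ring_1} set \<Rightarrow> bool" where
  "free_algebra N \<longleftrightarrow> (\<exists>B. freely_generates B N)"

definition infinitely_generated :: "'a::real_algebra set \<Rightarrow> bool" where
  "infinitely_generated N \<longleftrightarrow> (\<forall>G. subalgebra hull G = N \<longrightarrow> infinite G)"

end

theory Submission
  imports Defs
begin

text \<open>
  All sequences are built from thin spikes, one in the middle of each cell \<open>[k, k + 1)\<close>.  The spikes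
  are so narrow that even the enormous function \<open>envelope\<close>, whose value on the \<open>k\<close>-th spike is
  \<open>base k ^ (k ^ (2 ^ k))\<close>, is integrable.  A sequence whose members are eventually dominated by the
  envelope and whose \<open>n\<close>-th member vanishes before \<open>n\<close> (a \<open>tame\<close> sequence) automatically tends to 0
  in \<open>L1_norm\<close>, almost uniformly and in the metric of \<open>c0_X\<close>.  So only growth needs care.

  The generators \<open>gen A\<close> are indexed by the sets \<open>A\<close> of natural numbers.  On the \<open>k\<close>-th spike \<open>gen A\<close>
  has height \<open>base k ^ (k ^ c)\<close>, where \<open>c\<close> is a number below \<open>2 ^ k\<close> coding the part of \<open>A\<close> below \<open>k\<close>.
  The height of a product of generators is then \<open>base k\<close> raised to a number whose base-\<open>k\<close> digits are
  the exponents in the product.  By uniqueness of digits, distinct products have distinct heights on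
  all late spikes, and as \<open>base k\<close> outgrows \<open>\<alpha>\<close>, the highest one dominates in any linear combination.
  Hence every nontrivial linear combination of distinct nonconstant products of generators has
  growth \<open>\<alpha>\<close> and is tame (\<open>has_growth_combination\<close>, \<open>tame_combination\<close>).

  Strong algebrability is then immediate: the algebra generated by all \<open>gen A\<close> is the span of the
  products, and polynomial expressions in the generators are such combinations.

  For maximal dense-lineability, sequences with finitely many nonzero members of bounded support
  are dense in \<open>c0_X\<close>, and adding one to a combination of generators changes neither convergence
  nor growth.  There are as many index sets as elements of \<open>c0_X\<close>, so that each such sequence, at each
  accuracy, can be perturbed by a small multiple of a generator of its own.  The perturbed sequences
  span a dense subspace and are linearly independent, and by counting the subspace has the
  dimension of \<open>c0_X\<close>.
\<close>

section \<open>Pointwise evaluation\<close>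

lemma sum_fun_apply: "(\<Sum>i\<in>I. f i) x = (\<Sum>i\<in>I. f i x)"
  for f :: "'i \<Rightarrow> 'a \<Rightarrow> 'b::comm_monoid_add"
  by (induction I rule: infinite_finite_induct) auto

lemma prod_fun_apply: "(\<Prod>i\<in>I. f i) x = (\<Prod>i\<in>I. f i x)"
  for f :: "'i \<Rightarrow> 'a \<Rightarrow> 'b::comm_monoid_mult"
  by (induction I rule: infinite_finite_induct) auto

lemma power_fun_apply: "(f ^ k) x = f x ^ k"
  for f :: "'a \<Rightarrow> 'b::monoid_mult"
  by (induction k) auto

lemma diff_fun_apply: "(f - g) x = f x - g x"
  for f g :: "'a \<Rightarrow> 'b::ab_group_add"
  by simp

section \<open>The space of integrable continuous functions\<close>

lemma C_halflineI: "continuous_on {0..} f \<Longrightarrow> (\<And>x. x < 0 \<Longrightarrow> f x = 0) \<Longrightarrow> f \<in> C_halfline"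
  by (simp add: C_halfline_def)

lemma subspace_C_halfline: "subspace C_halfline"
proof (rule subspaceI)
  show "0 \<in> C_halfline"
    by (rule C_halflineI) (simp_all add: zero_fun_def)
next
  fix f g assume "f \<in> C_halfline" "g \<in> C_halfline"
  then show "f + g \<in> C_halfline"
    by (auto simp: C_halfline_def plus_fun_def intro!: continuous_intros)
next
  fix c f assume "f \<in> C_halfline"
  then show "c *\<^sub>R f \<in> C_halfline"
    by (auto simp: C_halfline_def scaleR_fun_def intro!: continuous_intros)
qed

lemma C_halfline_measurable: "f \<in> borel_measurable lebesgue" if "f \<in> C_halfline"
proof -
  have "(\<lambda>x. indicator {0..} x *\<^sub>R f x) \<in> borel_measurable borel"
    using that by (intro borel_measurable_continuous_on_indicator) (auto simp: C_halfline_def)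
  moreover have "(\<lambda>x. indicator {0..} x *\<^sub>R f x) = f"
    using that by (auto simp: C_halfline_def fun_eq_iff split: split_indicator)
  ultimately show ?thesis
    by (simp add: measurable_completion)
qed

text \<open>Since functions are extended by zero, integrals over the half line are integrals over the
  line.\<close>

lemma X_space_iff: "f \<in> X_space \<longleftrightarrow> f \<in> C_halfline \<and> integrable lebesgue f"
proof -
  have "(\<lambda>x. indicator {0..} x *\<^sub>R f x) = f" if "f \<in> C_halfline"
    using that by (auto simp: C_halfline_def fun_eq_iff split: split_indicator)
  then show ?thesis
    by (auto simp: X_space_def set_integrable_def)
qed

lemma L1_norm_eq: "L1_norm f = (LINT x|lebesgue. \<bar>f x\<bar>)" if "f \<in> C_halfline"
proof -
  have "(\<lambda>x. indicator {0..} x *\<^sub>R \<bar>f x\<bar>) = (\<lambda>x. \<bar>f x\<bar>)"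
    using that by (auto simp: C_halfline_def fun_eq_iff split: split_indicator)
  then show ?thesis
    by (simp add: L1_norm_def set_lebesgue_integral_def)
qed

lemma subspace_X_space: "subspace X_space"
proof (rule subspaceI)
  show "0 \<in> X_space"
    using subspace_0[OF subspace_C_halfline] by (simp add: X_space_iff zero_fun_def)
next
  fix f g assume "f \<in> X_space" "g \<in> X_space"
  then show "f + g \<in> X_space"
    using subspace_add[OF subspace_C_halfline] by (simp add: X_space_iff plus_fun_def)
next
  fix c f assume "f \<in> X_space"
  then show "c *\<^sub>R f \<in> X_space"
    using subspace_scale[OF subspace_C_halfline] by (simp add: X_space_iff scaleR_fun_def)
qed

lemma X_space_dominated:
  assumes "f \<in> C_halfline" "g \<in> X_space" "\<And>x. \<bar>f x\<bar> \<le> \<bar>g x\<bar>"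
  shows "f \<in> X_space"
  using assms C_halfline_measurable[OF assms(1)]
  by (auto simp: X_space_iff intro: Bochner_Integration.integrable_bound)

lemma L1_norm_nonneg: "0 \<le> L1_norm f"
  unfolding L1_norm_def set_lebesgue_integral_def by (rule integral_nonneg_AE) auto

lemma L1_norm_triangle: "L1_norm (f + g) \<le> L1_norm f + L1_norm g"
  if "f \<in> X_space" "g \<in> X_space"
proof -
  have int: "integrable lebesgue f" "integrable lebesgue g"
    using that by (auto simp: X_space_iff)
  have "(LINT x|lebesgue. \<bar>f x + g x\<bar>) \<le> (LINT x|lebesgue. \<bar>f x\<bar> + \<bar>g x\<bar>)"
    using int by (intro integral_mono) auto
  also have "\<dots> = (LINT x|lebesgue. \<bar>f x\<bar>) + (LINT x|lebesgue. \<bar>g x\<bar>)"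
    using int by simp
  finally show ?thesis
    using that subspace_add[OF subspace_X_space that]
    by (simp add: L1_norm_eq X_space_iff)
qed

lemma L1_norm_mono: "L1_norm f \<le> L1_norm g"
  if "f \<in> X_space" "g \<in> X_space" "\<And>x. \<bar>f x\<bar> \<le> \<bar>g x\<bar>"
  using that by (simp add: L1_norm_eq X_space_iff integral_mono)

lemma L1_norm_scaleR: "L1_norm (c *\<^sub>R f) = \<bar>c\<bar> * L1_norm f"
  by (simp add: L1_norm_def set_lebesgue_integral_def abs_mult mult.left_commute)

lemma sup_norm_bdd: "bdd_above ((\<lambda>x. \<bar>f x\<bar>) ` {0..real n})" if "f \<in> C_halfline"
proof -
  have "continuous_on {0..real n} f"
    using that by (auto simp: C_halfline_def intro: continuous_on_subset)
  then have "compact ((\<lambda>x. \<bar>f x\<bar>) ` {0..real n})"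
    by (intro compact_continuous_image continuous_intros) auto
  then show ?thesis
    by (simp add: bounded_imp_bdd_above compact_imp_bounded)
qed

lemma sup_norm_upper: "\<bar>f x\<bar> \<le> sup_norm n f" if "f \<in> C_halfline" "0 \<le> x" "x \<le> real n"
  unfolding sup_norm_def using that by (intro cSUP_upper sup_norm_bdd) auto

lemma sup_norm_least: "sup_norm n f \<le> c" if "\<And>x. 0 \<le> x \<Longrightarrow> x \<le> real n \<Longrightarrow> \<bar>f x\<bar> \<le> c"
  unfolding sup_norm_def using that by (intro cSUP_least) auto

lemma sup_norm_nonneg: "0 \<le> sup_norm n f" if "f \<in> C_halfline"
  using sup_norm_upper[OF that, of 0 n] by simp

lemma sup_norm_triangle: "sup_norm n (f + g) \<le> sup_norm n f + sup_norm n g"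
  if "f \<in> C_halfline" "g \<in> C_halfline"
proof (rule sup_norm_least)
  fix x :: real assume "0 \<le> x" "x \<le> real n"
  then show "\<bar>(f + g) x\<bar> \<le> sup_norm n f + sup_norm n g"
    using sup_norm_upper[OF that(1), of x n] sup_norm_upper[OF that(2), of x n] by auto
qed

lemma sup_norm_mono: "sup_norm n f \<le> sup_norm n g"
  if "g \<in> C_halfline" "\<And>x. \<bar>f x\<bar> \<le> \<bar>g x\<bar>"
  by (rule sup_norm_least) (meson order_trans sup_norm_upper that)

lemma sup_norm_scaleR_le: "sup_norm n (c *\<^sub>R f) \<le> \<bar>c\<bar> * sup_norm n f" if "f \<in> C_halfline"
  by (rule sup_norm_least) (auto simp: abs_mult intro!: mult_left_mono sup_norm_upper that)

section \<open>The metric as a translation invariant gauge\<close>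

text \<open>The metric is translation invariant, so all estimates can be made for the distance to \<open>0\<close>, the
  gauge below.  The bounded weights \<open>t / (1 + t)\<close> make it subadditive and monotone, but only
  quasi-homogeneous.\<close>

definition local_gauge :: "(real \<Rightarrow> real) \<Rightarrow> nat \<Rightarrow> real" where
  "local_gauge f k = 1 / 2 ^ Suc k * (sup_norm (Suc k) f / (1 + sup_norm (Suc k) f))"

definition gauge_X :: "(real \<Rightarrow> real) \<Rightarrow> real" where
  "gauge_X f = L1_norm f + suminf (local_gauge f)"

lemma d_X_eq: "d_X f g = gauge_X (f - g)"
  by (simp add: d_X_def gauge_X_def local_gauge_def[abs_def] Let_def)

lemma saturation_mono: "s / (1 + s) \<le> t / (1 + t)" if "0 \<le> s" "s \<le> t" for s t :: real
  using that by (simp add: field_simps)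

lemma saturation_add: "(s + t) / (1 + (s + t)) \<le> s / (1 + s) + t / (1 + t)"
  if "0 \<le> s" "0 \<le> t" for s t :: real
proof -
  have "s / (1 + (s + t)) \<le> s / (1 + s)" "t / (1 + (s + t)) \<le> t / (1 + t)"
    using that by (auto intro!: divide_left_mono)
  then show ?thesis by (simp add: add_divide_distrib)
qed

lemma saturation_scale: "c * t / (1 + c * t) \<le> c * (t / (1 + t))"
  if "1 \<le> c" "0 \<le> t" for c t :: real
proof -
  have "1 * t \<le> c * t" using that by (intro mult_right_mono)
  then have "c * t / (1 + c * t) \<le> c * t / (1 + t)"
    using that by (intro divide_left_mono) auto
  then show ?thesis by simp
qed

lemma local_gauge_nonneg: "0 \<le> local_gauge f k" if "f \<in> C_halfline"
  using sup_norm_nonneg[OF that, of "Suc k"] by (simp add: local_gauge_def)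

lemma local_gauge_le: "local_gauge f k \<le> (1/2) ^ k" if "f \<in> C_halfline"
proof -
  have "sup_norm (Suc k) f / (1 + sup_norm (Suc k) f) \<le> 1"
    using sup_norm_nonneg[OF that, of "Suc k"] by simp
  then have "local_gauge f k \<le> 1 / 2 ^ Suc k * 1"
    unfolding local_gauge_def by (intro mult_left_mono) auto
  also have "\<dots> \<le> (1/2) ^ k" by (simp add: power_divide field_simps)
  finally show ?thesis .
qed

lemma local_gauge_summable: "summable (local_gauge f)" if "f \<in> C_halfline"
proof (rule summable_comparison_test')
  show "summable (\<lambda>k. (1/2::real) ^ k)" by (simp add: summable_geometric)
  show "norm (local_gauge f k) \<le> (1/2) ^ k" if "0 \<le> k" for k
    using local_gauge_nonneg[OF \<open>f \<in> C_halfline\<close>] local_gauge_le[OF \<open>f \<in> C_halfline\<close>] by simp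
qed

lemma gauge_X_nonneg: "0 \<le> gauge_X f" if "f \<in> C_halfline"
  unfolding gauge_X_def
  by (intro add_nonneg_nonneg L1_norm_nonneg suminf_nonneg local_gauge_summable that
      local_gauge_nonneg)

lemma gauge_X_triangle: "gauge_X (f + g) \<le> gauge_X f + gauge_X g"
  if "f \<in> X_space" "g \<in> X_space"
proof -
  have C: "f \<in> C_halfline" "g \<in> C_halfline" "f + g \<in> C_halfline"
    using that subspace_add[OF subspace_C_halfline] by (auto simp: X_space_iff)
  have "local_gauge (f + g) k \<le> local_gauge f k + local_gauge g k" for k
  proof -
    let ?s = "sup_norm (Suc k) f" and ?t = "sup_norm (Suc k) g"
    have "sup_norm (Suc k) (f + g) / (1 + sup_norm (Suc k) (f + g)) \<le> (?s + ?t) / (1 + (?s + ?t))"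
      by (intro saturation_mono sup_norm_nonneg sup_norm_triangle C)
    also have "\<dots> \<le> ?s / (1 + ?s) + ?t / (1 + ?t)"
      by (intro saturation_add sup_norm_nonneg C)
    finally show ?thesis
      unfolding local_gauge_def distrib_left[symmetric] by (rule mult_left_mono) simp
  qed
  then have "suminf (local_gauge (f + g)) \<le> suminf (\<lambda>k. local_gauge f k + local_gauge g k)"
    by (intro suminf_le summable_add local_gauge_summable C)
  also have "\<dots> = suminf (local_gauge f) + suminf (local_gauge g)"
    by (intro suminf_add[symmetric] local_gauge_summable C)
  finally show ?thesis
    using L1_norm_triangle[OF that] by (simp add: gauge_X_def)
qed

lemma gauge_X_mono: "gauge_X f \<le> gauge_X g"
  if "f \<in> X_space" "g \<in> X_space" "\<And>x. \<bar>f x\<bar> \<le> \<bar>g x\<bar>"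
proof -
  have C: "f \<in> C_halfline" "g \<in> C_halfline"
    using that by (auto simp: X_space_iff)
  have "local_gauge f k \<le> local_gauge g k" for k
    unfolding local_gauge_def
    by (intro mult_left_mono saturation_mono sup_norm_nonneg sup_norm_mono C that) auto
  then show ?thesis
    unfolding gauge_X_def using L1_norm_mono[OF that]
    by (intro add_mono suminf_le local_gauge_summable C)
qed

lemma gauge_X_scaleR_le: "gauge_X (c *\<^sub>R f) \<le> (1 + \<bar>c\<bar>) * gauge_X f" if "f \<in> X_space"
proof -
  have C: "f \<in> C_halfline" "c *\<^sub>R f \<in> C_halfline"
    using that subspace_scale[OF subspace_C_halfline] by (auto simp: X_space_iff)
  let ?c = "1 + \<bar>c\<bar>"
  have "local_gauge (c *\<^sub>R f) k \<le> ?c * local_gauge f k" for k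
  proof -
    let ?s = "sup_norm (Suc k) f"
    have "sup_norm (Suc k) (c *\<^sub>R f) \<le> \<bar>c\<bar> * ?s"
      by (intro sup_norm_scaleR_le C)
    also have "\<dots> \<le> ?c * ?s"
      by (intro mult_right_mono sup_norm_nonneg C) auto
    finally have "sup_norm (Suc k) (c *\<^sub>R f) / (1 + sup_norm (Suc k) (c *\<^sub>R f))
        \<le> ?c * ?s / (1 + ?c * ?s)"
      by (intro saturation_mono sup_norm_nonneg C)
    also have "\<dots> \<le> ?c * (?s / (1 + ?s))"
      by (intro saturation_scale sup_norm_nonneg C) auto
    finally have "1 / 2 ^ Suc k * (sup_norm (Suc k) (c *\<^sub>R f) / (1 + sup_norm (Suc k) (c *\<^sub>R f)))
      \<le> 1 / 2 ^ Suc k * (?c * (?s / (1 + ?s)))"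
      by (rule mult_left_mono) simp
    also have "\<dots> = ?c * (1 / 2 ^ Suc k * (?s / (1 + ?s)))"
      by (rule mult.left_commute)
    finally show ?thesis
      unfolding local_gauge_def .
  qed
  then have "suminf (local_gauge (c *\<^sub>R f)) \<le> suminf (\<lambda>k. ?c * local_gauge f k)"
    by (intro suminf_le summable_mult local_gauge_summable C)
  also have "\<dots> = ?c * suminf (local_gauge f)"
    by (intro suminf_mult local_gauge_summable C)
  finally have "suminf (local_gauge (c *\<^sub>R f)) \<le> ?c * suminf (local_gauge f)" .
  moreover have "L1_norm (c *\<^sub>R f) \<le> ?c * L1_norm f"
    unfolding L1_norm_scaleR by (intro mult_right_mono L1_norm_nonneg) auto
  ultimately show ?thesis
    by (simp add: gauge_X_def distrib_left)
qed

text \<open>Convergence in the metric follows from convergence of each seminorm separately: the weights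
  \<open>1 / 2 ^ k\<close> dominate the series of local gauges, so that the limit may be taken termwise by Tannery's
  theorem.\<close>

lemma gauge_X_tendsto_0:
  assumes X: "\<And>j. u j \<in> X_space"
    and L1: "(\<lambda>j. L1_norm (u j)) \<longlonglongrightarrow> 0"
    and sup: "\<And>m. (\<lambda>j. sup_norm m (u j)) \<longlonglongrightarrow> 0"
  shows "(\<lambda>j. gauge_X (u j)) \<longlonglongrightarrow> 0"
proof -
  have C: "u j \<in> C_halfline" for j
    using X by (simp add: X_space_iff)
  have "(\<lambda>j. suminf (local_gauge (u j))) \<longlonglongrightarrow> suminf (\<lambda>k. 0)"
  proof (intro tannerys_theorem[THEN conjunct2, THEN conjunct2])
    show "(\<lambda>j. local_gauge (u j) k) \<longlonglongrightarrow> 0" for k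
      unfolding local_gauge_def
      by (rule tendsto_eq_intros sup refl)+ auto
    show "summable (\<lambda>k. (1/2::real) ^ k)" by (simp add: summable_geometric)
    show "\<forall>\<^sub>F (k, j) in at_top \<times>\<^sub>F sequentially. norm (local_gauge (u j) k) \<le> (1/2) ^ k"
      using local_gauge_nonneg[OF C] local_gauge_le[OF C] by (intro always_eventually) auto
  qed auto
  then have "(\<lambda>j. gauge_X (u j)) \<longlonglongrightarrow> 0 + 0"
    unfolding gauge_X_def by (intro tendsto_add L1) simp
  then show ?thesis by simp
qed

lemma c0_X_iff: "F \<in> c0_X \<longleftrightarrow> (\<forall>n. F n \<in> X_space) \<and> (\<lambda>n. gauge_X (F n)) \<longlonglongrightarrow> 0"
  by (simp add: c0_X_def d_X_eq)

lemma subspace_c0_X: "subspace c0_X"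
proof (rule subspaceI)
  have "gauge_X 0 = 0"
  proof -
    have "sup_norm n 0 = 0" for n by (simp add: sup_norm_def)
    then show ?thesis
      by (simp add: gauge_X_def local_gauge_def[abs_def] L1_norm_def)
  qed
  then show "0 \<in> c0_X"
    using subspace_0[OF subspace_X_space] by (simp add: c0_X_iff)
next
  fix F G assume FG: "F \<in> c0_X" "G \<in> c0_X"
  then have X: "F n \<in> X_space" "G n \<in> X_space" "F n + G n \<in> X_space" for n
    using subspace_add[OF subspace_X_space] by (auto simp: c0_X_iff)
  have "(\<lambda>n. gauge_X (F n) + gauge_X (G n)) \<longlonglongrightarrow> 0 + 0"
    using FG by (intro tendsto_add) (auto simp: c0_X_iff)
  then have "(\<lambda>n. gauge_X (F n) + gauge_X (G n)) \<longlonglongrightarrow> 0" by simp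
  moreover have bd: "norm (gauge_X (F n + G n)) \<le> gauge_X (F n) + gauge_X (G n)" for n
    using gauge_X_triangle[OF X(1) X(2)] gauge_X_nonneg[of "F n + G n"] X(3)
    by (simp add: X_space_iff)
  ultimately have "(\<lambda>n. gauge_X (F n + G n)) \<longlonglongrightarrow> 0"
    by (intro Lim_null_comparison[OF always_eventually[OF allI[OF bd]]])
  then show "F + G \<in> c0_X"
    using X by (simp add: c0_X_iff)
next
  fix c F assume F: "F \<in> c0_X"
  then have X: "F n \<in> X_space" "c *\<^sub>R F n \<in> X_space" for n
    using subspace_scale[OF subspace_X_space] by (auto simp: c0_X_iff)
  have "(\<lambda>n. (1 + \<bar>c\<bar>) * gauge_X (F n)) \<longlonglongrightarrow> (1 + \<bar>c\<bar>) * 0"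
    using F by (intro tendsto_mult tendsto_const) (auto simp: c0_X_iff)
  then have "(\<lambda>n. (1 + \<bar>c\<bar>) * gauge_X (F n)) \<longlonglongrightarrow> 0" by simp
  moreover have bd: "norm (gauge_X (c *\<^sub>R F n)) \<le> (1 + \<bar>c\<bar>) * gauge_X (F n)" for n
    using gauge_X_scaleR_le[OF X(1)] gauge_X_nonneg[of "c *\<^sub>R F n"] X(2)
    by (simp add: X_space_iff)
  ultimately have "(\<lambda>n. gauge_X (c *\<^sub>R F n)) \<longlonglongrightarrow> 0"
    by (intro Lim_null_comparison[OF always_eventually[OF allI[OF bd]]])
  then show "c *\<^sub>R F \<in> c0_X"
    using X by (simp add: c0_X_iff)
qed

lemma damped_tendsto_0:
  assumes u: "u \<in> X_space"
    and v: "\<And>j. v j \<in> C_halfline"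
    and bound: "\<And>j x. \<bar>v j x\<bar> \<le> \<bar>u x\<bar>"
    and damp: "\<And>j x. N \<le> j \<Longrightarrow> x \<le> real j \<Longrightarrow> \<bar>v j x\<bar> \<le> \<bar>u x\<bar> / real (Suc j)"
  shows "(\<lambda>j. gauge_X (v j)) \<longlonglongrightarrow> 0"
proof (rule gauge_X_tendsto_0)
  have uC: "u \<in> C_halfline" using u by (simp add: X_space_iff)
  show vX: "v j \<in> X_space" for j
    using X_space_dominated[OF v u bound] .
  have inv: "(\<lambda>j. c / real (Suc j)) \<longlonglongrightarrow> 0" for c :: real
    using tendsto_mult_right_zero[OF LIMSEQ_inverse_real_of_nat, of c] by (simp add: divide_inverse)
  have "(\<lambda>j. v j x) \<longlonglongrightarrow> 0" for x
  proof (rule Lim_null_comparison[OF _ inv])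
    show "\<forall>\<^sub>F j in sequentially. norm (v j x) \<le> \<bar>u x\<bar> / real (Suc j)"
      using eventually_ge_at_top[of "max N (nat \<lceil>x\<rceil>)"]
      by eventually_elim (auto intro!: damp simp del: of_nat_Suc)
  qed
  then have lim: "(\<lambda>j. \<bar>v j x\<bar>) \<longlonglongrightarrow> 0" for x
    by (intro tendsto_rabs_zero)
  have "(\<lambda>j. LINT x|lebesgue. \<bar>v j x\<bar>) \<longlonglongrightarrow> (LINT x::real|lebesgue. 0::real)"
  proof (rule integral_dominated_convergence)
    show "integrable lebesgue (\<lambda>x. \<bar>u x\<bar>)"
      using u by (simp add: X_space_iff)
    show "(\<lambda>x. \<bar>v j x\<bar>) \<in> borel_measurable lebesgue" for j
      using C_halfline_measurable[OF v] by simp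
  qed (use lim bound in auto)
  then show "(\<lambda>j. L1_norm (v j)) \<longlonglongrightarrow> 0"
    by (simp add: L1_norm_eq[OF v])
  show "(\<lambda>j. sup_norm m (v j)) \<longlonglongrightarrow> 0" for m
  proof (rule Lim_null_comparison[OF _ inv])
    show "\<forall>\<^sub>F j in sequentially. norm (sup_norm m (v j)) \<le> sup_norm m u / real (Suc j)"
      using eventually_ge_at_top[of "max N m"]
    proof eventually_elim
      case (elim j)
      have "\<bar>v j x\<bar> \<le> sup_norm m u / real (Suc j)" if "0 \<le> x" "x \<le> real m" for x
      proof -
        have "\<bar>v j x\<bar> \<le> \<bar>u x\<bar> / real (Suc j)"
          using elim that by (intro damp) auto
        also have "\<dots> \<le> sup_norm m u / real (Suc j)"
          using that by (intro divide_right_mono sup_norm_upper uC) auto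
        finally show ?thesis .
      qed
      then show ?case
        using sup_norm_nonneg[OF v] by (simp add: sup_norm_least del: of_nat_Suc)
    qed
  qed
qed

text \<open>Both approximations used later, cutting a sequence off far out and multiplying it by a small
  scalar, replace \<open>F\<close> by functions dominated by \<open>F\<close> that become small on every fixed compact set.
  The distance is then small uniformly in \<open>n\<close>: late members of \<open>F\<close> are small by themselves, and the
  finitely many early ones are treated one at a time by dominated convergence.\<close>

lemma damped_uniformly_small:
  assumes F: "F \<in> c0_X"
    and V: "\<And>j n. V j n \<in> C_halfline"
    and bound: "\<And>j n x. \<bar>V j n x\<bar> \<le> \<bar>F n x\<bar>"
    and damp: "\<And>j n x. n \<le> j \<Longrightarrow> x \<le> real j \<Longrightarrow> \<bar>V j n x\<bar> \<le> \<bar>F n x\<bar> / real (Suc j)"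
    and "0 < \<delta>"
  shows "\<forall>\<^sub>F j in sequentially. \<forall>n. gauge_X (V j n) \<le> \<delta>"
proof -
  have FX: "F n \<in> X_space" for n
    using F by (simp add: c0_X_iff)
  have "\<forall>\<^sub>F n in sequentially. gauge_X (F n) < \<delta>"
    using F \<open>0 < \<delta>\<close> by (intro order_tendstoD(2)[of _ 0]) (auto simp: c0_X_iff)
  then obtain N where N: "gauge_X (F n) < \<delta>" if "N \<le> n" for n
    by (auto simp: eventually_sequentially)
  have tail: "gauge_X (V j n) \<le> \<delta>" if "N \<le> n" for j n
  proof -
    have "V j n \<in> X_space" using X_space_dominated[OF V FX bound] .
    then have "gauge_X (V j n) \<le> gauge_X (F n)" by (intro gauge_X_mono FX bound)
    then show ?thesis using N[OF that] by simp
  qed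
  have "\<forall>\<^sub>F j in sequentially. gauge_X (V j n) < \<delta>" for n
    using \<open>0 < \<delta>\<close> by (intro order_tendstoD(2)[of _ 0] damped_tendsto_0[OF FX V bound damp, of n n])
  then have "\<forall>\<^sub>F j in sequentially. \<forall>n\<in>{..<N}. gauge_X (V j n) < \<delta>"
    by (intro eventually_ball_finite) auto
  then show ?thesis
  proof eventually_elim
    case (elim j)
    then show ?case using tail by (metis lessThan_iff less_imp_le not_le)
  qed
qed

section \<open>Uniqueness of digits\<close>

text \<open>If two digit strings differ, then at the lowest position of disagreement the difference of the two
  numbers is not divisible by the next power of \<open>k\<close>.\<close>

lemma digits_unique:
  fixes a b \<sigma> :: "'i \<Rightarrow> nat"
  assumes "finite J" "inj_on \<sigma> J" "\<And>i. i \<in> J \<Longrightarrow> a i < k" "\<And>i. i \<in> J \<Longrightarrow> b i < k"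
    and eq: "(\<Sum>i\<in>J. a i * k ^ \<sigma> i) = (\<Sum>i\<in>J. b i * k ^ \<sigma> i)"
    and "j \<in> J"
  shows "a j = b j"
proof (rule ccontr)
  assume "a j \<noteq> b j"
  define D where "D = {i \<in> J. a i \<noteq> b i}"
  have "finite D" "j \<in> D"
    using assms \<open>a j \<noteq> b j\<close> by (auto simp: D_def)
  then obtain i where i: "i \<in> D" "\<And>i'. i' \<in> D \<Longrightarrow> \<sigma> i \<le> \<sigma> i'"
    using ex_min_if_finite[of "\<sigma> ` D"] by (metis empty_iff finite_imageI image_iff not_le image_is_empty)
  let ?d = "\<lambda>i. int (a i) - int (b i)" and ?k = "int k"
  have "(\<Sum>i\<in>J. ?d i * ?k ^ \<sigma> i) = int (\<Sum>i\<in>J. a i * k ^ \<sigma> i) - int (\<Sum>i\<in>J. b i * k ^ \<sigma> i)"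
    by (simp add: left_diff_distrib sum_subtractf)
  then have "0 = (\<Sum>i\<in>J. ?d i * ?k ^ \<sigma> i)"
    using eq by simp
  also have "\<dots> = (\<Sum>i\<in>D. ?d i * ?k ^ \<sigma> i)"
    by (rule sum.mono_neutral_right) (use assms in \<open>auto simp: D_def\<close>)
  also have "\<dots> = ?d i * ?k ^ \<sigma> i + (\<Sum>i'\<in>D - {i}. ?d i' * ?k ^ \<sigma> i')"
    using \<open>finite D\<close> i by (simp add: sum.remove)
  finally have *: "?d i * ?k ^ \<sigma> i = - (\<Sum>i'\<in>D - {i}. ?d i' * ?k ^ \<sigma> i')"
    by simp
  have "?k ^ Suc (\<sigma> i) dvd (\<Sum>i'\<in>D - {i}. ?d i' * ?k ^ \<sigma> i')"
  proof (rule dvd_sum)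
    fix i' assume i': "i' \<in> D - {i}"
    then have "\<sigma> i \<noteq> \<sigma> i'"
      using inj_onD[OF \<open>inj_on \<sigma> J\<close>] i by (auto simp: D_def)
    then have "Suc (\<sigma> i) \<le> \<sigma> i'"
      using i(2)[of i'] i' by auto
    then show "?k ^ Suc (\<sigma> i) dvd ?d i' * ?k ^ \<sigma> i'"
      by (intro dvd_mult le_imp_power_dvd)
  qed
  then have "?k ^ Suc (\<sigma> i) dvd ?d i * ?k ^ \<sigma> i"
    unfolding * by simp
  moreover have "a i < k" "b i < k" "a i \<noteq> b i"
    using i assms by (auto simp: D_def)
  ultimately have "?k dvd ?d i"
    by simp
  then have "\<bar>?d i\<bar> \<ge> ?k"
    using \<open>a i \<noteq> b i\<close> dvd_imp_le_int[of "?d i" ?k] by simp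
  then show False
    using \<open>a i < k\<close> \<open>b i < k\<close> by linarith
qed

text \<open>Sets of natural numbers index the generators.  Different sets have different initial segments from
  some point on; the binary number coding the initial segment of length \<open>k\<close> is therefore a position
  below \<open>2 ^ k\<close> that eventually tells any finitely many index sets apart.\<close>

definition prefix_code :: "nat set \<Rightarrow> nat \<Rightarrow> nat" where
  "prefix_code A k = set_encode (A \<inter> {..<k})"

lemma prefix_code_less: "prefix_code A k < 2 ^ k"
proof -
  have "prefix_code A k \<le> (\<Sum>i\<in>{0..<k}. 2 ^ i)"
    unfolding prefix_code_def set_encode_def by (rule sum_mono2) auto
  then show ?thesis
    by (auto simp: sum_power2 intro: le_less_trans)
qed

lemma prefix_code_eventually_distinct:
  assumes "A \<noteq> B"
  shows "\<forall>\<^sub>F k in sequentially. prefix_code A k \<noteq> prefix_code B k"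
proof -
  obtain j where j: "j \<in> A \<longleftrightarrow> j \<notin> B"
    using assms by blast
  show ?thesis
    using eventually_gt_at_top[of j]
    by eventually_elim (use j in \<open>auto simp: prefix_code_def set_encode_eq set_eq_iff\<close>)
qed

definition power_product :: "('i \<Rightarrow> 'a) \<Rightarrow> ('i \<Rightarrow>\<^sub>0 nat) \<Rightarrow> 'a::comm_monoid_mult" where
  "power_product f m = (\<Prod>i\<in>Poly_Mapping.keys m. f i ^ Poly_Mapping.lookup m i)"

definition total_degree :: "('i \<Rightarrow>\<^sub>0 nat) \<Rightarrow> nat" where
  "total_degree m = (\<Sum>i\<in>Poly_Mapping.keys m. Poly_Mapping.lookup m i)"

lemma total_degree_pos: "0 < total_degree m" if "m \<noteq> 0"
  using that by (auto simp: total_degree_def in_keys_iff sum_pos intro!: sum_pos)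

text \<open>At the \<open>k\<close>-th spike the generator with index set \<open>A i\<close> has height \<open>b ^ (k ^ prefix_code (A i) k)\<close>
  for a large base \<open>b\<close>.  A power product then has height \<open>b\<close> to the power of the weight, the number
  whose base-\<open>k\<close> digits are the exponents of the power product.\<close>

definition weight :: "('i \<Rightarrow> nat set) \<Rightarrow> ('i \<Rightarrow>\<^sub>0 nat) \<Rightarrow> nat \<Rightarrow> nat" where
  "weight A m k = (\<Sum>i\<in>Poly_Mapping.keys m. Poly_Mapping.lookup m i * k ^ prefix_code (A i) k)"

text \<open>Once \<open>k\<close> exceeds all exponents these really are base-\<open>k\<close> digits, and once the prefix codes of the
  finitely many indices are distinct no two digits share a position; then the weight determines the
  power product.\<close>

lemma weight_eventually_distinct:
  assumes "finite J" "inj_on A J" "Poly_Mapping.keys m \<subseteq> J" "Poly_Mapping.keys m' \<subseteq> J" "m \<noteq> m'"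
  shows "\<forall>\<^sub>F k in sequentially. weight A m k \<noteq> weight A m' k"
proof -
  have "\<forall>\<^sub>F k in sequentially. \<forall>i\<in>J. \<forall>j\<in>J. i \<noteq> j \<longrightarrow> prefix_code (A i) k \<noteq> prefix_code (A j) k"
  proof (intro eventually_ball_finite ballI \<open>finite J\<close>)
    fix i j assume "i \<in> J" "j \<in> J"
    show "\<forall>\<^sub>F k in sequentially. i \<noteq> j \<longrightarrow> prefix_code (A i) k \<noteq> prefix_code (A j) k"
    proof (cases "i = j")
      case False
      then have "A i \<noteq> A j" using \<open>i \<in> J\<close> \<open>j \<in> J\<close> inj_onD[OF assms(2)] by blast
      then show ?thesis using prefix_code_eventually_distinct by (auto elim: eventually_mono)
    qed simp
  qed
  moreover have "\<forall>\<^sub>F k in sequentially. \<forall>i\<in>J. Poly_Mapping.lookup m i < k"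
    "\<forall>\<^sub>F k in sequentially. \<forall>i\<in>J. Poly_Mapping.lookup m' i < k"
    by (intro eventually_ball_finite ballI \<open>finite J\<close> eventually_gt_at_top)+
  ultimately show ?thesis
  proof eventually_elim
    case (elim k)
    have on_J: "weight A m k = (\<Sum>i\<in>J. Poly_Mapping.lookup m i * k ^ prefix_code (A i) k)"
      "weight A m' k = (\<Sum>i\<in>J. Poly_Mapping.lookup m' i * k ^ prefix_code (A i) k)"
      unfolding weight_def using assms(1,3,4)
      by (auto intro!: sum.mono_neutral_left simp: in_keys_iff)
    show ?case
    proof
      assume "weight A m k = weight A m' k"
      then have "Poly_Mapping.lookup m j = Poly_Mapping.lookup m' j" if "j \<in> J" for j
        using digits_unique[OF assms(1), of "\<lambda>i. prefix_code (A i) k" "Poly_Mapping.lookup m" k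
            "Poly_Mapping.lookup m'" j] elim that on_J by (auto simp: inj_on_def)
      moreover have "Poly_Mapping.lookup m j = 0" "Poly_Mapping.lookup m' j = 0" if "j \<notin> J" for j
        using that assms by (auto simp: in_keys_iff)
      ultimately show False
        using \<open>m \<noteq> m'\<close> by (metis poly_mapping_eqI)
    qed
  qed
qed

lemma weight_pos: "0 < weight A m k" if "m \<noteq> 0" "0 < k"
  unfolding weight_def using that by (intro sum_pos) (auto simp: in_keys_iff)

text \<open>All digit positions are below \<open>2 ^ k\<close> and the digits sum up to less than \<open>k\<close>.\<close>

lemma weight_less: "weight A m k < k ^ (2 ^ k)" if "total_degree m < k"
proof -
  have code_le: "prefix_code B k \<le> 2 ^ k - 1" for B
    using prefix_code_less[of B k] by simp
  have "weight A m k \<le> (\<Sum>i\<in>Poly_Mapping.keys m. Poly_Mapping.lookup m i * k ^ (2 ^ k - 1))"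
    unfolding weight_def using that code_le
    by (intro sum_mono mult_left_mono power_increasing) auto
  also have "\<dots> = total_degree m * k ^ (2 ^ k - 1)"
    by (simp add: total_degree_def sum_distrib_right)
  also have "\<dots> < k * k ^ (2 ^ k - 1)"
    using that by simp
  also have "\<dots> = k ^ (2 ^ k)"
    by (simp flip: power_Suc)
  finally show ?thesis .
qed

section \<open>Spikes\<close>

definition cell :: "real \<Rightarrow> nat" where
  "cell x = nat \<lfloor>x\<rfloor>"

lemma cell_bounds: "real (cell x) \<le> x" "x < real (cell x) + 1" if "0 \<le> x"
  using that unfolding cell_def by linarith+

lemma cell_eqI: "cell x = k" if "real k \<le> x" "x < real k + 1"
  using that unfolding cell_def by linarith

lemma has_growthI:
  assumes "\<And>r. \<exists>\<^sub>F x in at_top. r \<le> \<bar>f x\<bar> / \<alpha> x"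
  shows "has_growth \<alpha> f"
proof -
  have "ereal r \<le> Limsup at_top (\<lambda>x. ereal (\<bar>f x\<bar> / \<alpha> x))" for r
  proof (rule ccontr)
    assume "\<not> ?thesis"
    then have "\<forall>\<^sub>F x in at_top. ereal (\<bar>f x\<bar> / \<alpha> x) < ereal r"
      by (intro Limsup_lessD) simp
    then show False
      using assms[of r] by (simp add: frequently_def not_le)
  qed
  then show ?thesis
    unfolding has_growth_def by (rule ereal_top)
qed

lemma has_growth_cong: "has_growth \<alpha> f \<longleftrightarrow> has_growth \<alpha> g" if "\<And>x. R \<le> x \<Longrightarrow> f x = g x"
proof -
  have "Limsup at_top (\<lambda>x. ereal (\<bar>f x\<bar> / \<alpha> x)) = Limsup at_top (\<lambda>x. ereal (\<bar>g x\<bar> / \<alpha> x))"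
    by (intro Limsup_eq eventually_mono[OF eventually_ge_at_top[of R]]) (simp add: that)
  then show ?thesis
    by (simp add: has_growth_def)
qed

lemma not_has_growth_0: "\<not> has_growth \<alpha> 0"
  by (simp add: has_growth_def Limsup_const)

locale growth_bound =
  fixes \<alpha> :: "real \<Rightarrow> real"
  assumes mono: "mono_on {0..} \<alpha>"
    and ge_1: "\<And>x. 0 \<le> x \<Longrightarrow> 1 \<le> \<alpha> x"
begin

text \<open>The base is at least \<open>(k + 2) * \<alpha> x\<close> on the whole cell \<open>[k, k + 1)\<close>, because \<open>\<alpha>\<close> is nondecreasing.
  The cap bounds every power product of generators at the \<open>k\<close>-th spike as soon as \<open>k\<close> is large.  The
  slope makes the spike so narrow that a function bounded by the cap contributes at most \<open>1 / 2 ^ k\<close>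
  to the integral; the factor 4 keeps the spike away from the ends of its cell.\<close>

definition base :: "nat \<Rightarrow> real" where
  "base k = real (k + 2) * \<alpha> (real (k + 1))"

definition cap :: "nat \<Rightarrow> real" where
  "cap k = base k ^ (k ^ (2 ^ k))"

definition slope :: "nat \<Rightarrow> real" where
  "slope k = 4 * 2 ^ k * cap k"

definition tent :: "real \<Rightarrow> real" where
  "tent x = (if x < 0 then 0 else max 0 (1 - slope (cell x) * \<bar>x - (real (cell x) + 1/2)\<bar>))"

text \<open>A single integrable function that controls all sequences of the construction.  Since its nonzero
  values are at least 1, integrability also makes the set where it is nonzero have finite
  measure.\<close>

definition envelope :: "real \<Rightarrow> real" where
  "envelope x = (if 0 < tent x then cap (cell x) else 0)"

lemma base_ge: "real (k + 2) \<le> base k"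
proof -
  have "real (k + 2) * 1 \<le> base k"
    unfolding base_def by (intro mult_left_mono ge_1) auto
  then show ?thesis by simp
qed

lemma base_ge_1: "1 \<le> base k"
  using base_ge[of k] by simp

lemma cap_ge_1: "1 \<le> cap k"
  unfolding cap_def by (intro one_le_power base_ge_1)

lemma slope_ge_4: "4 \<le> slope k"
proof -
  have "1 * 1 \<le> 2 ^ k * cap k"
    by (intro mult_mono cap_ge_1) auto
  then show ?thesis unfolding slope_def by simp
qed

lemma tent_nonneg: "0 \<le> tent x"
  by (simp add: tent_def)

lemma tent_le_1: "tent x \<le> 1"
  using slope_ge_4[of "cell x"] by (simp add: tent_def)

lemma tent_center: "tent (real k + 1/2) = 1"
proof -
  have "cell (real k + 1/2) = k" by (intro cell_eqI) auto
  then show ?thesis by (simp add: tent_def)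
qed

lemma tent_pos_dist: "\<bar>x - (real (cell x) + 1/2)\<bar> < 1 / slope (cell x)" if "0 < tent x"
proof -
  have "slope (cell x) * \<bar>x - (real (cell x) + 1/2)\<bar> < 1"
    using that by (auto simp: tent_def less_max_iff_disj split: if_splits)
  then show ?thesis
    using slope_ge_4[of "cell x"] by (simp add: pos_less_divide_eq mult.commute)
qed

lemma tent_eq_0_near_nat: "tent y = 0" if "\<bar>y - real k\<bar> < 1/4"
proof (rule ccontr)
  assume "tent y \<noteq> 0"
  then have "0 < tent y" using tent_nonneg[of y] by simp
  moreover have "1 / slope (cell y) \<le> 1/4"
    using slope_ge_4[of "cell y"] by (simp add: field_simps)
  ultimately have "\<bar>y - (real (cell y) + 1/2)\<bar> < 1/4"
    using tent_pos_dist[of y] by simp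
  then have "real k < real (Suc (cell y))" "real (cell y) < real k"
    using that unfolding of_nat_Suc by linarith+
  then show False by (simp only: of_nat_less_iff)
qed

text \<open>The heights may jump at the integers, but the spikes vanish in a neighbourhood of each integer.\<close>

lemma continuous_spikes: "continuous_on UNIV (\<lambda>x. v (cell x) * tent x)"
proof (intro continuous_at_imp_continuous_on ballI)
  fix x :: real
  consider "x < 0" | k where "x = real k" | k where "real k < x" "x < real k + 1"
    using cell_bounds[of x] by (metis less_eq_real_def not_le)
  then show "isCont (\<lambda>x. v (cell x) * tent x) x"
  proof cases
    case 1
    then have "\<forall>\<^sub>F y in nhds x. y \<in> {..<0}"
      by (intro eventually_nhds_in_open) auto
    then have "\<forall>\<^sub>F y in nhds x. v (cell y) * tent y = 0"
      by eventually_elim (simp add: tent_def)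
    from isCont_cong[OF this] show ?thesis by simp
  next
    case (2 k)
    then have "\<forall>\<^sub>F y in nhds x. y \<in> ball (real k) (1/4)"
      by (intro eventually_nhds_in_open) auto
    then have "\<forall>\<^sub>F y in nhds x. v (cell y) * tent y = 0"
      by eventually_elim (auto simp: dist_real_def abs_minus_commute intro: tent_eq_0_near_nat)
    from isCont_cong[OF this] show ?thesis by simp
  next
    case (3 k)
    then have "\<forall>\<^sub>F y in nhds x. y \<in> {real k<..<real k + 1}"
      by (intro eventually_nhds_in_open) auto
    then have "\<forall>\<^sub>F y in nhds x. v (cell y) * tent y
        = v k * max 0 (1 - slope k * \<bar>y - (real k + 1/2)\<bar>)"
    proof eventually_elim
      case (elim y)
      then have "cell y = k" "0 \<le> y" by (auto intro!: cell_eqI)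
      then show ?case by (simp add: tent_def)
    qed
    moreover have "isCont (\<lambda>y. v k * max 0 (1 - slope k * \<bar>y - (real k + 1/2)\<bar>)) x"
      by (intro continuous_intros)
    ultimately show ?thesis
      by (simp only: isCont_cong)
  qed
qed

lemma cell_measurable [measurable]: "cell \<in> borel \<rightarrow>\<^sub>M count_space UNIV"
  unfolding cell_def[abs_def] by measurable

lemma tent_measurable [measurable]: "tent \<in> borel_measurable borel"
  using borel_measurable_continuous_onI[OF continuous_spikes[of "\<lambda>_. 1"]] by simp

lemma envelope_nonneg: "0 \<le> envelope x"
  using cap_ge_1[of "cell x"] by (simp add: envelope_def)

lemma envelope_measurable [measurable]: "envelope \<in> borel_measurable borel"
  unfolding envelope_def[abs_def] by measurable

text \<open>The \<open>k\<close>-th spike lies in an interval of length \<open>2 / slope k\<close>, so its integral is at most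
  \<open>2 * cap k / slope k = 1 / 2 ^ (k + 1)\<close>.\<close>

lemma envelope_integrable: "integrable lebesgue envelope"
proof -
  define I where "I k = {real k + 1/2 - 1 / slope k .. real k + 1/2 + 1 / slope k}" for k
  have I: "ennreal (cap k) * emeasure lborel (I k) = ennreal ((1/2) ^ k / 2)" for k
  proof -
    have "cap k * (2 / slope k) = (1/2) ^ k / 2"
      using cap_ge_1[of k] by (simp add: slope_def power_divide field_simps)
    moreover have "emeasure lborel (I k) = ennreal (2 / slope k)"
      using slope_ge_4[of k] by (simp add: I_def)
    ultimately show ?thesis
      using cap_ge_1[of k] slope_ge_4[of k] by (simp flip: ennreal_mult)
  qed
  have "ennreal (envelope x) \<le> suminf (\<lambda>k. ennreal (cap k) * indicator (I k) x)" for x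
  proof (cases "0 < tent x")
    case True
    then have "ennreal (envelope x) = ennreal (cap (cell x)) * indicator (I (cell x)) x"
      using tent_pos_dist[OF True] by (auto simp: envelope_def I_def abs_less_iff split: split_indicator)
    also have "\<dots> = (\<Sum>k\<in>{cell x}. ennreal (cap k) * indicator (I k) x)"
      by (simp only: sum.insert_remove finite.emptyI Diff_empty empty_Diff sum.empty add_0_right)
    also have "\<dots> \<le> suminf (\<lambda>k. ennreal (cap k) * indicator (I k) x)"
      by (rule sum_le_suminf) auto
    finally show ?thesis .
  qed (simp add: envelope_def)
  then have "(\<integral>\<^sup>+x. ennreal (envelope x) \<partial>lborel)
      \<le> (\<integral>\<^sup>+x. suminf (\<lambda>k. ennreal (cap k) * indicator (I k) x) \<partial>lborel)"
    by (rule nn_integral_mono)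
  also have "\<dots> = suminf (\<lambda>k. \<integral>\<^sup>+x. ennreal (cap k) * indicator (I k) x \<partial>lborel)"
    by (rule nn_integral_suminf) (simp add: I_def)
  also have "\<dots> = suminf (\<lambda>k. ennreal ((1/2) ^ k / 2))"
    by (simp add: nn_integral_cmult_indicator I[symmetric] I_def)
  also have "\<dots> < top"
    unfolding less_top[symmetric]
    by (intro ennreal_suminf_neq_top summable_divide summable_geometric) auto
  finally have "integrable lborel envelope"
    by (intro integrableI_nonneg) (auto simp: envelope_nonneg)
  then show ?thesis
    by (rule integrable_completion[THEN iffD2, rotated]) auto
qed

section \<open>Sequences carried by the spikes\<close>

text \<open>Eventual domination by the envelope in the space variable, together with a first nonzero value
  that moves to infinity with \<open>n\<close>, is all that the convergence requirements need.\<close>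

definition tame :: "(nat \<Rightarrow> real \<Rightarrow> real) \<Rightarrow> bool" where
  "tame F \<longleftrightarrow> (\<forall>n. F n \<in> C_halfline) \<and>
     (\<exists>K. (\<forall>n x. real K \<le> x \<longrightarrow> \<bar>F n x\<bar> \<le> envelope x) \<and> (\<forall>n\<ge>K. \<forall>x<real n. F n x = 0))"

lemma tame_dominated:
  assumes "tame F"
  shows "\<exists>K. \<forall>n\<ge>K. \<forall>x. \<bar>F n x\<bar> \<le> envelope x \<and> (x < real n \<longrightarrow> F n x = 0)"
proof -
  obtain K where K: "\<forall>n x. real K \<le> x \<longrightarrow> \<bar>F n x\<bar> \<le> envelope x"
    "\<forall>n\<ge>K. \<forall>x<real n. F n x = 0"
    using assms unfolding tame_def by blast
  have "\<bar>F n x\<bar> \<le> envelope x" if "K \<le> n" for n x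
  proof (cases "x < real n")
    case True
    then show ?thesis using K(2) that envelope_nonneg[of x] by simp
  next
    case False
    then have "real K \<le> x" using that by linarith
    then show ?thesis using K(1) by blast
  qed
  then show ?thesis using K by blast
qed

lemma tame_X_space: "F n \<in> X_space" if "tame F"
proof -
  obtain K where C: "F n \<in> C_halfline" and K: "\<And>x. real K \<le> x \<Longrightarrow> \<bar>F n x\<bar> \<le> envelope x"
    using \<open>tame F\<close> unfolding tame_def by blast
  let ?g = "\<lambda>x. sup_norm K (F n) * indicator {0..real K} x + envelope x"
  have "integrable lebesgue ?g"
    by (intro Bochner_Integration.integrable_add integrable_mult_right envelope_integrable
        integrable_real_indicator) auto
  moreover have "norm (F n x) \<le> norm (?g x)" for x
  proof -
    consider "x < 0" | "0 \<le> x" "x \<le> real K" | "real K < x" by linarith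
    then show ?thesis
    proof cases
      case 1
      then show ?thesis using C by (simp add: C_halfline_def)
    next
      case 2
      then show ?thesis using sup_norm_upper[OF C 2] envelope_nonneg[of x] by simp
    next
      case 3
      then show ?thesis using K[of x] by simp
    qed
  qed
  ultimately have "integrable lebesgue (F n)"
    using C_halfline_measurable[OF C] by - (rule Bochner_Integration.integrable_bound[of _ ?g], auto)
  then show ?thesis using C by (simp add: X_space_iff)
qed

text \<open>Dominated convergence with the envelope: at each point only finitely many members are nonzero.\<close>

lemma tame_L1_norm_tendsto_0: "(\<lambda>n. L1_norm (F n)) \<longlonglongrightarrow> 0" if "tame F"
proof -
  obtain K where "\<forall>n\<ge>K. \<forall>x. \<bar>F n x\<bar> \<le> envelope x \<and> (x < real n \<longrightarrow> F n x = 0)"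
    using tame_dominated[OF \<open>tame F\<close>] by (rule exE)
  then have K: "\<bar>F n x\<bar> \<le> envelope x" "x < real n \<Longrightarrow> F n x = 0" if "K \<le> n" for n x
    using that by blast+
  have C: "F n \<in> C_halfline" for n using that by (simp add: tame_def)
  have "(\<lambda>n. LINT x|lebesgue. \<bar>F (n + K) x\<bar>) \<longlonglongrightarrow> (LINT x::real|lebesgue. 0::real)"
  proof (rule integral_dominated_convergence[OF _ _ envelope_integrable])
    show "(\<lambda>x. \<bar>F (n + K) x\<bar>) \<in> borel_measurable lebesgue" for n
      using C_halfline_measurable[OF C] by simp
    have "(\<lambda>n. \<bar>F (n + K) x\<bar>) \<longlonglongrightarrow> 0" for x
    proof (rule tendsto_eventually)
      show "\<forall>\<^sub>F n in sequentially. \<bar>F (n + K) x\<bar> = 0"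
        using eventually_gt_at_top[of "nat \<lceil>x\<rceil>"]
      proof eventually_elim
        case (elim n)
        then have "x < real (n + K)" by linarith
        then show ?case using K(2)[of "n + K" x] by simp
      qed
    qed
    then show "AE x in lebesgue. (\<lambda>n. \<bar>F (n + K) x\<bar>) \<longlonglongrightarrow> 0" by simp
    show "AE x in lebesgue. norm \<bar>F (n + K) x\<bar> \<le> envelope x" for n
      using K(1) by simp
  qed simp
  then show ?thesis
    by - (rule LIMSEQ_offset[of "\<lambda>n. L1_norm (F n)" K], simp add: L1_norm_eq[OF C])
qed

lemma tame_c0_X: "F \<in> c0_X" if "tame F"
proof -
  obtain K where "\<forall>n\<ge>K. \<forall>x. \<bar>F n x\<bar> \<le> envelope x \<and> (x < real n \<longrightarrow> F n x = 0)"
    using tame_dominated[OF \<open>tame F\<close>] by (rule exE)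
  then have K: "F n x = 0" if "K \<le> n" "x < real n" for n x
    using that by blast
  have "(\<lambda>n. sup_norm m (F n)) \<longlonglongrightarrow> 0" for m
  proof (rule tendsto_eventually)
    show "\<forall>\<^sub>F n in sequentially. sup_norm m (F n) = 0"
      using eventually_gt_at_top[of "max m K"]
    proof eventually_elim
      case (elim n)
      then have "F n x = 0" if "x \<in> {0..real m}" for x
        using K[of n x] that by simp
      then show ?case by (simp add: sup_norm_def)
    qed
  qed
  then have "(\<lambda>n. gauge_X (F n)) \<longlonglongrightarrow> 0"
    by (rule gauge_X_tendsto_0[OF tame_X_space[OF that] tame_L1_norm_tendsto_0[OF that]])
  then show ?thesis
    using tame_X_space[OF that] by (simp add: c0_X_iff)
qed

text \<open>The exceptional set consists of the spikes beyond \<open>N\<close>.  Its measure tends to 0, as these sets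
  decrease to the empty set and have finite measure, and outside of it all members with index at
  least \<open>N\<close> vanish identically.\<close>

lemma tame_almost_uniform: "almost_uniform_limit F 0" if "tame F"
proof -
  obtain K where "\<forall>n\<ge>K. \<forall>x. \<bar>F n x\<bar> \<le> envelope x \<and> (x < real n \<longrightarrow> F n x = 0)"
    using tame_dominated[OF \<open>tame F\<close>] by (rule exE)
  then have K: "\<bar>F n x\<bar> \<le> envelope x" "x < real n \<Longrightarrow> F n x = 0" if "K \<le> n" for n x
    using that by blast+
  define E where "E N = {x. real N \<le> x \<and> 0 < tent x}" for N
  have E_borel: "E N \<in> sets borel" for N
    unfolding E_def by measurable
  have E_finite: "emeasure lebesgue (E N) \<noteq> \<infinity>" for N
  proof -
    have "emeasure lebesgue (E N) = (\<integral>\<^sup>+x. indicator (E N) x \<partial>lebesgue)"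
      using E_borel by simp
    also have "\<dots> \<le> (\<integral>\<^sup>+x. ennreal (envelope x) \<partial>lebesgue)"
      using cap_ge_1 by (intro nn_integral_mono) (auto simp: E_def envelope_def split: split_indicator)
    also have "\<dots> < \<infinity>"
      using envelope_integrable envelope_nonneg by (simp add: integrable_iff_bounded)
    finally show ?thesis by simp
  qed
  have "(\<lambda>N. emeasure lebesgue (E N)) \<longlonglongrightarrow> emeasure lebesgue (\<Inter>N. E N)"
    using E_borel E_finite
    by (intro Lim_emeasure_decseq) (auto simp: decseq_def E_def)
  moreover have "(\<Inter>N. E N) = {}"
  proof -
    have "x \<notin> (\<Inter>N. E N)" for x
    proof -
      obtain N where "x < real N" using reals_Archimedean2 by blast
      then have "x \<notin> E N" by (simp add: E_def)
      then show ?thesis by blast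
    qed
    then show ?thesis by blast
  qed
  ultimately have E_lim: "(\<lambda>N. emeasure lebesgue (E N)) \<longlonglongrightarrow> 0"
    by simp
  show ?thesis
    unfolding almost_uniform_limit_def
  proof (intro allI impI)
    fix \<epsilon> :: real assume "0 < \<epsilon>"
    then have "\<forall>\<^sub>F N in sequentially. emeasure lebesgue (E N) < ennreal \<epsilon>"
      by (intro order_tendstoD(2)[OF E_lim]) simp
    then have "\<forall>\<^sub>F N in sequentially. K \<le> N \<and> emeasure lebesgue (E N) < ennreal \<epsilon>"
      using eventually_ge_at_top[of K] by eventually_elim simp
    then obtain N where N: "K \<le> N" "emeasure lebesgue (E N) < ennreal \<epsilon>"
      by (auto simp: eventually_sequentially)
    have "F n x = 0" if "N \<le> n" "x \<notin> E N" for n x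
    proof (cases "x < real n")
      case True
      then show ?thesis using K(2)[of n x] N that by simp
    next
      case False
      then have "\<not> 0 < tent x" using that by (auto simp: E_def)
      then show ?thesis using K(1)[of n x] N that by (simp add: envelope_def)
    qed
    then have "uniform_limit ({0..} - E N) F 0 sequentially"
      by (intro uniform_limitI eventually_mono[OF eventually_ge_at_top[of N]]) auto
    moreover have "E N \<subseteq> {0..}" by (auto simp: E_def)
    ultimately show "\<exists>E. E \<in> sets lebesgue \<and> E \<subseteq> {0..} \<and> emeasure lebesgue E \<le> ennreal \<epsilon> \<and>
        uniform_limit ({0..} - E) F 0 sequentially"
      using N E_borel by (intro exI[of _ "E N"]) auto
  qed
qed

lemma tame_A0: "F \<in> A0 \<alpha>" if "tame F" "\<And>n. has_growth \<alpha> (F n)"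
  using that tame_X_space tame_L1_norm_tendsto_0 tame_almost_uniform by (simp add: A0_def)

text \<open>Sequences with finitely many nonzero members, all supported in one bounded interval.  They can be
  added to a tame sequence without affecting its convergence or the growth of its members, and they
  are dense in \<open>c0_X\<close>.\<close>

definition truncated :: "(nat \<Rightarrow> real \<Rightarrow> real) \<Rightarrow> bool" where
  "truncated G \<longleftrightarrow> (\<forall>n. G n \<in> C_halfline) \<and> (\<exists>R. \<forall>n x. R \<le> n \<or> real R \<le> x \<longrightarrow> G n x = 0)"

lemma tame_add_truncated:
  assumes "tame F" "truncated G"
  shows "tame (F + G)"
proof -
  obtain K where K: "\<forall>n x. real K \<le> x \<longrightarrow> \<bar>F n x\<bar> \<le> envelope x"
    "\<forall>n\<ge>K. \<forall>x<real n. F n x = 0"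
    using assms(1) unfolding tame_def by blast
  obtain R where R: "\<forall>n x. R \<le> n \<or> real R \<le> x \<longrightarrow> G n x = 0"
    using assms(2) unfolding truncated_def by blast
  have "\<bar>(F + G) n x\<bar> \<le> envelope x" if "real (max K R) \<le> x" for n x
  proof -
    have "real K \<le> x" "real R \<le> x"
      using that by (simp_all add: of_nat_max)
    then show ?thesis
      using K(1)[rule_format, of x n] R[rule_format, of n x] by simp
  qed
  moreover have "(F + G) n x = 0" if "max K R \<le> n" "x < real n" for n x
    using K(2)[rule_format, of n x] R[rule_format, of n x] that by simp
  moreover have "(F + G) n \<in> C_halfline" for n
    using assms subspace_add[OF subspace_C_halfline] by (simp add: tame_def truncated_def)
  ultimately show ?thesis
    unfolding tame_def by blast
qed

lemma has_growth_add_truncated: "has_growth \<alpha> ((F + G) n) \<longleftrightarrow> has_growth \<alpha> (F n)" if "truncated G"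
proof -
  obtain R where R: "\<forall>n x. R \<le> n \<or> real R \<le> x \<longrightarrow> G n x = 0"
    using \<open>truncated G\<close> unfolding truncated_def by blast
  show ?thesis
    by (rule has_growth_cong[of "real R"]) (simp add: R)
qed

lemma subspace_truncated: "subspace (Collect truncated)"
proof (rule subspaceI)
  show "0 \<in> Collect truncated"
    using subspace_0[OF subspace_C_halfline] by (auto simp: truncated_def)
next
  fix F G assume *: "F \<in> Collect truncated" "G \<in> Collect truncated"
  then obtain R R' where R: "\<forall>n x. R \<le> n \<or> real R \<le> x \<longrightarrow> F n x = 0"
    "\<forall>n x. R' \<le> n \<or> real R' \<le> x \<longrightarrow> G n x = 0"
    unfolding truncated_def by blast
  have "\<exists>R. \<forall>n x. R \<le> n \<or> real R \<le> x \<longrightarrow> (F + G) n x = 0"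
  proof (intro exI[of _ "max R R'"] allI impI)
    fix n x assume "max R R' \<le> n \<or> real (max R R') \<le> x"
    then show "(F + G) n x = 0"
      using R(1)[rule_format, of n x] R(2)[rule_format, of n x] by fastforce
  qed
  then show "F + G \<in> Collect truncated"
    using * subspace_add[OF subspace_C_halfline] by (simp add: truncated_def)
next
  fix c F assume *: "F \<in> Collect truncated"
  then show "c *\<^sub>R F \<in> Collect truncated"
    using subspace_scale[OF subspace_C_halfline] by (fastforce simp: truncated_def)
qed

end

text \<open>Growth is tested along the tops of the spikes.\<close>

lemma frequently_along_sequence:
  assumes "\<forall>\<^sub>F k in sequentially. P (u k)" "filterlim u F sequentially"
  shows "\<exists>\<^sub>F x in F. P x"
proof -
  have False if "\<forall>\<^sub>F x in F. \<not> P x"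
  proof -
    have "\<forall>\<^sub>F k in sequentially. \<not> P (u k)"
      using eventually_compose_filterlim[OF that assms(2)] .
    with assms(1) have "\<forall>\<^sub>F k :: nat in sequentially. False"
      by eventually_elim blast
    then show False by simp
  qed
  then show ?thesis by (auto simp: frequently_def)
qed

context growth_bound
begin

section \<open>The generators and the combinations of their power products\<close>

definition gen :: "nat set \<Rightarrow> nat \<Rightarrow> real \<Rightarrow> real" where
  "gen A n x = (if n \<le> cell x then base (cell x) ^ (cell x ^ prefix_code A (cell x)) else 0) * tent x"

lemma power_product_gen:
  assumes "m \<noteq> 0"
  shows "power_product (\<lambda>i. gen (A i)) m n x
    = (if n \<le> cell x then base (cell x) ^ weight A m (cell x) else 0) * tent x ^ total_degree m"
proof -
  let ?k = "cell x" and ?l = "Poly_Mapping.lookup m"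
  have *: "power_product (\<lambda>i. gen (A i)) m n x = (\<Prod>i\<in>Poly_Mapping.keys m. gen (A i) n x ^ ?l i)"
    by (simp add: power_product_def prod_fun_apply power_fun_apply)
  show ?thesis
  proof (cases "n \<le> ?k")
    case True
    have "(\<Prod>i\<in>Poly_Mapping.keys m. gen (A i) n x ^ ?l i)
      = (\<Prod>i\<in>Poly_Mapping.keys m. base ?k ^ (?l i * ?k ^ prefix_code (A i) ?k) * tent x ^ ?l i)"
      using True by (intro prod.cong) (auto simp: gen_def power_mult_distrib mult.commute simp flip: power_mult)
    then show ?thesis
      using True unfolding * by (simp add: prod.distrib weight_def total_degree_def power_sum)
  next
    case False
    obtain i where "i \<in> Poly_Mapping.keys m"
      using assms by (metis all_not_in_conv keys_eq_empty)
    then have "(\<Prod>i\<in>Poly_Mapping.keys m. gen (A i) n x ^ ?l i) = 0"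
      using False by (intro prod_zero) (auto simp: gen_def in_keys_iff)
    then show ?thesis
      using False unfolding * by simp
  qed
qed

lemma power_product_gen_C_halfline:
  assumes "m \<noteq> 0"
  shows "power_product (\<lambda>i. gen (A i)) m n \<in> C_halfline"
proof -
  let ?v = "\<lambda>k. if n \<le> k then base k ^ weight A m k else 0"
  obtain d where d: "total_degree m = Suc d"
    using total_degree_pos[OF assms] gr0_conv_Suc by blast
  have "power_product (\<lambda>i. gen (A i)) m n = (\<lambda>x. (?v (cell x) * tent x) * (1 * tent x) ^ d)"
    by (simp add: fun_eq_iff power_product_gen[OF assms] d)
  moreover have "continuous_on {0..} (\<lambda>x. (?v (cell x) * tent x) * (1 * tent x) ^ d)"
    using continuous_on_subset[OF continuous_spikes[of ?v], of "{0..}"]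
      continuous_on_subset[OF continuous_spikes[of "\<lambda>_. 1"], of "{0..}"]
    by (intro continuous_on_mult[OF _ continuous_on_power]) auto
  ultimately show ?thesis
    by (intro C_halflineI) (auto simp: tent_def)
qed

definition combination :: "('i \<Rightarrow> nat set) \<Rightarrow> ('i \<Rightarrow>\<^sub>0 nat) set \<Rightarrow> (('i \<Rightarrow>\<^sub>0 nat) \<Rightarrow> real)
    \<Rightarrow> nat \<Rightarrow> real \<Rightarrow> real" where
  "combination A S c = (\<Sum>m\<in>S. c m *\<^sub>R power_product (\<lambda>i. gen (A i)) m)"

lemma combination_apply:
  "combination A S c n x = (\<Sum>m\<in>S. c m * power_product (\<lambda>i. gen (A i)) m n x)"
  by (simp add: combination_def sum_fun_apply)

text \<open>All weights involved are eventually smaller than \<open>k ^ (2 ^ k)\<close>; the one remaining factor \<open>base k\<close>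
  absorbs the sum of the absolute values of the coefficients.\<close>

lemma tame_combination:
  assumes "finite S" "0 \<notin> S"
  shows "tame (combination A S c)"
proof -
  let ?p = "power_product (\<lambda>i. gen (A i))" and ?H = "combination A S c"
  define C where "C = (\<Sum>m\<in>S. \<bar>c m\<bar>)"
  have nz: "m \<noteq> 0" if "m \<in> S" for m
    using assms(2) that by blast
  have "?H n = (\<Sum>m\<in>S. c m *\<^sub>R ?p m n)" for n
    by (simp add: combination_def sum_fun_apply)
  then have H_C: "?H n \<in> C_halfline" for n
    using nz by (auto intro!: subspace_sum subspace_scale subspace_C_halfline power_product_gen_C_halfline)
  have vanish: "?H n x = 0" if "\<not> 0 < tent x \<or> cell x < n" for n x
  proof -
    have "?p m n x = 0" if "m \<in> S" for m
      using \<open>\<not> 0 < tent x \<or> cell x < n\<close> tent_nonneg[of x] total_degree_pos[OF nz[OF that]]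
      by (auto simp: power_product_gen[OF nz[OF that]])
    then show ?thesis by (simp add: combination_apply)
  qed
  have "\<forall>\<^sub>F k in sequentially. \<forall>m\<in>S. total_degree m < k"
    using assms(1) by (intro eventually_ball_finite ballI eventually_gt_at_top) auto
  then have "\<forall>\<^sub>F k in sequentially. C \<le> real k \<and> 0 < k \<and> (\<forall>m\<in>S. total_degree m < k)"
    using eventually_ge_at_top[of "nat \<lceil>C\<rceil>"] eventually_gt_at_top[of 0]
  proof eventually_elim
    case (elim k)
    then show ?case using real_nat_ceiling_ge[of C] by auto
  qed
  then obtain K where K: "\<And>k. K \<le> k \<Longrightarrow> C \<le> real k"
    "\<And>k. K \<le> k \<Longrightarrow> 0 < k"
    "\<And>k m. K \<le> k \<Longrightarrow> m \<in> S \<Longrightarrow> total_degree m < k"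
    unfolding eventually_sequentially by blast
  have bound: "\<bar>?H n x\<bar> \<le> envelope x" if "real K \<le> x" for n x
  proof (cases "0 < tent x")
    case True
    define k where "k = cell x"
    have "K \<le> k"
      using cell_bounds[of x] that unfolding k_def by linarith
    \<comment> \<open>the largest weight possible at this spike\<close>
    define w where "w = k ^ (2 ^ k) - 1"
    have p_le: "\<bar>?p m n x\<bar> \<le> base k ^ w" if "m \<in> S" for m
    proof -
      have "weight A m k \<le> w"
        using weight_less[OF K(3)[OF \<open>K \<le> k\<close> that], of A] by (simp add: w_def)
      then have "base k ^ weight A m k * tent x ^ total_degree m \<le> base k ^ w * 1"
        using base_ge_1[of k] tent_nonneg[of x] tent_le_1[of x]
        by (intro mult_mono power_increasing power_le_one) auto
      then show ?thesis
        using base_ge_1[of k] tent_nonneg[of x] by (simp add: power_product_gen[OF nz[OF that]] k_def)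
    qed
    have "\<bar>?H n x\<bar> \<le> (\<Sum>m\<in>S. \<bar>c m * ?p m n x\<bar>)"
      unfolding combination_apply by (rule sum_abs)
    also have "\<dots> \<le> (\<Sum>m\<in>S. \<bar>c m\<bar> * base k ^ w)"
      by (intro sum_mono) (simp add: abs_mult mult_left_mono p_le)
    also have "\<dots> = C * base k ^ w"
      by (simp add: C_def sum_distrib_right)
    also have "\<dots> \<le> base k * base k ^ w"
      using K(1)[OF \<open>K \<le> k\<close>] base_ge[of k] base_ge_1[of k] by (intro mult_right_mono) auto
    also have "\<dots> = cap k"
    proof -
      have "k ^ (2 ^ k) = Suc w"
        using K(2)[OF \<open>K \<le> k\<close>] by (simp add: w_def)
      then show ?thesis by (simp add: cap_def)
    qed
    finally show ?thesis
      using True by (simp add: envelope_def k_def)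
  next
    case False
    then show ?thesis using vanish[of x n] by (simp add: envelope_def)
  qed
  have start: "?H n x = 0" if "x < real n" for n x
  proof (cases "x < 0")
    case True
    then show ?thesis using vanish[of x n] by (simp add: tent_def)
  next
    case False
    then have "cell x < n" using cell_bounds[of x] that by linarith
    then show ?thesis using vanish by blast
  qed
  show ?thesis
    unfolding tame_def using H_C bound start by blast
qed

text \<open>At the top of a late spike the combination is a sum of distinct powers of the base.  The term of
  largest weight exceeds all the others together by a factor of order \<open>base k\<close>, which is at least
  \<open>k * \<alpha> x\<close>, whereas the coefficients are fixed.  Which term is the largest may depend on \<open>k\<close>;
  using the smallest absolute value of a coefficient makes the estimate uniform.\<close>

lemma has_growth_combination:
  assumes "finite S" "S \<noteq> {}" "0 \<notin> S" "\<And>m. m \<in> S \<Longrightarrow> c m \<noteq> 0"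
    and "finite J" "inj_on A J" "\<And>m. m \<in> S \<Longrightarrow> Poly_Mapping.keys m \<subseteq> J"
  shows "has_growth \<alpha> (combination A S c n)"
proof (rule has_growthI)
  fix r :: real
  let ?H = "combination A S c n"
  define C where "C = (\<Sum>m\<in>S. \<bar>c m\<bar>)"
  define c0 where "c0 = Min ((\<lambda>m. \<bar>c m\<bar>) ` S)"
  have c0: "0 < c0" "\<And>m. m \<in> S \<Longrightarrow> c0 \<le> \<bar>c m\<bar>"
    using assms(1,2,4) by (auto simp: c0_def)
  have nz: "m \<noteq> 0" if "m \<in> S" for m
    using assms(3) that by blast
  have "\<forall>\<^sub>F k in sequentially. m \<noteq> m' \<longrightarrow> weight A m k \<noteq> weight A m' k" if "m \<in> S" "m' \<in> S" for m m'
    using weight_eventually_distinct[OF assms(5,6) assms(7)[OF that(1)] assms(7)[OF that(2)]]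
    by (cases "m = m'") (auto elim: eventually_mono)
  then have "\<forall>\<^sub>F k in sequentially. \<forall>m\<in>S. \<forall>m'\<in>S. m \<noteq> m' \<longrightarrow> weight A m k \<noteq> weight A m' k"
    by (intro eventually_ball_finite ballI assms(1)) auto
  then have "\<forall>\<^sub>F k in sequentially. r \<le> \<bar>?H (real k + 1/2)\<bar> / \<alpha> (real k + 1/2)"
    using eventually_ge_at_top[of n] eventually_gt_at_top[of 0]
      eventually_ge_at_top[of "nat \<lceil>(max r 0 + C) / c0\<rceil>"]
  proof eventually_elim
    case (elim k)
    define x where "x = real k + 1/2"
    have cell_x: "cell x = k"
      unfolding x_def by (rule cell_eqI) auto
    define w where "w m = weight A m k" for m
    have H: "?H x = (\<Sum>m\<in>S. c m * base k ^ w m)"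
      unfolding combination_apply
      by (intro sum.cong refl) (use elim(2) tent_center[of k] in \<open>simp add: power_product_gen[OF nz] cell_x w_def flip: x_def\<close>)
    obtain m0 where m0: "m0 \<in> S" "\<And>m. m \<in> S \<Longrightarrow> w m \<le> w m0"
    proof -
      have "Max (w ` S) \<in> w ` S" using assms(1,2) by simp
      then obtain m0 where "m0 \<in> S" "w m0 = Max (w ` S)" by auto
      then show thesis using assms(1) by (intro that[of m0]) auto
    qed
    \<comment> \<open>the weights are distinct, so all others are at most one less than the largest\<close>
    define e where "e = w m0 - 1"
    have e: "w m0 = Suc e"
      using weight_pos[OF nz[OF m0(1)] elim(3), of A] by (simp add: e_def w_def)
    have w_le: "w m \<le> e" if "m \<in> S - {m0}" for m
    proof -
      have "w m \<noteq> w m0" using elim(1) that m0(1) by (auto simp: w_def)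
      then show ?thesis using m0(2)[of m] that e by auto
    qed
    have "\<bar>\<Sum>m\<in>S - {m0}. c m * base k ^ w m\<bar> \<le> (\<Sum>m\<in>S - {m0}. \<bar>c m * base k ^ w m\<bar>)"
      by (rule sum_abs)
    also have "\<dots> \<le> (\<Sum>m\<in>S - {m0}. \<bar>c m\<bar> * base k ^ e)"
      using base_ge_1[of k] w_le
      by (intro sum_mono) (auto simp: abs_mult intro!: mult_left_mono power_increasing)
    also have "\<dots> \<le> (\<Sum>m\<in>S. \<bar>c m\<bar> * base k ^ e)"
      using base_ge_1[of k] assms(1) by (intro sum_mono2) auto
    also have "\<dots> = C * base k ^ e"
      by (simp add: C_def sum_distrib_right)
    finally have rest: "\<bar>\<Sum>m\<in>S - {m0}. c m * base k ^ w m\<bar> \<le> C * base k ^ e" .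
    have "c0 * base k * base k ^ e \<le> \<bar>c m0\<bar> * base k * base k ^ e"
      using base_ge_1[of k] c0(2)[OF m0(1)] by (intro mult_right_mono) auto
    also have "\<dots> = \<bar>c m0 * base k ^ w m0\<bar>"
      using base_ge_1[of k] by (simp add: abs_mult e)
    finally have lead: "c0 * base k * base k ^ e \<le> \<bar>c m0 * base k ^ w m0\<bar>" .
    have "?H x = c m0 * base k ^ w m0 + (\<Sum>m\<in>S - {m0}. c m * base k ^ w m)"
      unfolding H using assms(1) m0(1) by (rule sum.remove)
    then have lower: "(c0 * base k - C) * base k ^ e \<le> \<bar>?H x\<bar>"
      using rest lead by (simp add: left_diff_distrib)
    have "1 \<le> \<alpha> x"
      by (rule ge_1) (simp add: x_def)
    have "(max r 0 + C) / c0 \<le> real k + 2"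
      using elim(4) by linarith
    then have r_le: "max r 0 \<le> c0 * (real k + 2) - C"
      using c0(1) by (simp only: pos_divide_le_eq mult.commute[of c0] le_diff_eq)
    have "\<alpha> x \<le> \<alpha> (real (k + 1))"
      by (rule mono_onD[OF mono]) (auto simp: x_def)
    then have "c0 * (real k + 2) * \<alpha> x \<le> c0 * base k"
      using c0(1) by (simp add: base_def mult.assoc add.commute)
    moreover have "C * 1 \<le> C * \<alpha> x"
      using \<open>1 \<le> \<alpha> x\<close> by (intro mult_left_mono) (auto simp: C_def intro: sum_nonneg)
    ultimately have "(c0 * (real k + 2) - C) * \<alpha> x \<le> c0 * base k - C"
      by (simp add: left_diff_distrib)
    moreover have "max r 0 * \<alpha> x \<le> (c0 * (real k + 2) - C) * \<alpha> x"
      using r_le \<open>1 \<le> \<alpha> x\<close> by (intro mult_right_mono) auto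
    ultimately have big: "max r 0 * \<alpha> x \<le> c0 * base k - C"
      by linarith
    moreover have "0 \<le> max r 0 * \<alpha> x"
      using \<open>1 \<le> \<alpha> x\<close> by simp
    ultimately have "(c0 * base k - C) * 1 \<le> (c0 * base k - C) * base k ^ e"
      using base_ge_1[of k] by (intro mult_left_mono one_le_power) auto
    have "r * \<alpha> x \<le> max r 0 * \<alpha> x"
      using \<open>1 \<le> \<alpha> x\<close> by (intro mult_right_mono) auto
    also note big
    also have "c0 * base k - C \<le> (c0 * base k - C) * base k ^ e"
      using \<open>(c0 * base k - C) * 1 \<le> (c0 * base k - C) * base k ^ e\<close> by simp
    also note lower
    finally have "r * \<alpha> x \<le> \<bar>?H x\<bar>" .
    then show ?case
      using \<open>1 \<le> \<alpha> x\<close> by (simp add: pos_le_divide_eq x_def)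
  qed
  moreover have "filterlim (\<lambda>k. real k + 1/2) at_top sequentially"
    using filterlim_tendsto_add_at_top[OF tendsto_const[of "1/2"] filterlim_real_sequentially]
    by (simp add: add.commute)
  ultimately show "\<exists>\<^sub>F x in at_top. r \<le> \<bar>?H x\<bar> / \<alpha> x"
    by (rule frequently_along_sequence)
qed

end

section \<open>Spans and subalgebras\<close>

lemma span_image_explicit:
  fixes v :: "'i \<Rightarrow> 'a::real_vector"
  assumes "x \<in> span (v ` I)"
  obtains S c where "finite S" "S \<subseteq> I" "x = (\<Sum>i\<in>S. c i *\<^sub>R v i)" "\<forall>i\<in>S. c i \<noteq> 0"
proof -
  obtain t r where t: "finite t" "t \<subseteq> v ` I" "x = (\<Sum>a\<in>t. r a *\<^sub>R a)"
    using assms by (auto simp: span_explicit)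
  obtain S where S: "S \<subseteq> I" "inj_on v S" "t = v ` S"
    using t(2) by (auto simp: subset_image_inj)
  have "finite S" using t(1) S finite_imageD by blast
  have "x = (\<Sum>i\<in>S. r (v i) *\<^sub>R v i)"
    using t(3) S by (simp add: sum.reindex)
  also have "\<dots> = (\<Sum>i\<in>{i \<in> S. r (v i) \<noteq> 0}. r (v i) *\<^sub>R v i)"
    using \<open>finite S\<close> by (intro sum.mono_neutral_right) auto
  finally show thesis
    using S(1) \<open>finite S\<close> by (intro that[of "{i \<in> S. r (v i) \<noteq> 0}" "\<lambda>i. r (v i)"]) auto
qed

lemma independent_family:
  fixes v :: "'i \<Rightarrow> 'a::real_vector"
  assumes nz: "\<And>S c. finite S \<Longrightarrow> S \<noteq> {} \<Longrightarrow> S \<subseteq> I \<Longrightarrow> \<forall>i\<in>S. c i \<noteq> 0 \<Longrightarrow>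
      (\<Sum>i\<in>S. c i *\<^sub>R v i) \<noteq> 0"
  shows "inj_on v I" "independent (v ` I)"
proof -
  show "inj_on v I"
  proof (rule inj_onI, rule ccontr)
    fix i j assume ij: "i \<in> I" "j \<in> I" "v i = v j" "i \<noteq> j"
    then have "(\<Sum>l\<in>{i, j}. (if l = i then 1 else - 1) *\<^sub>R v l) = 0"
      by simp
    moreover have "(\<Sum>l\<in>{i, j}. (if l = i then 1 else - 1) *\<^sub>R v l) \<noteq> 0"
      by (rule nz) (use ij in auto)
    ultimately show False by blast
  qed
  show "independent (v ` I)"
  proof
    assume "dependent (v ` I)"
    then obtain t u where t: "finite t" "t \<subseteq> v ` I" "(\<Sum>a\<in>t. u a *\<^sub>R a) = 0" "\<exists>a\<in>t. u a \<noteq> 0"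
      by (auto simp: dependent_explicit)
    obtain S where S: "S \<subseteq> I" "inj_on v S" "t = v ` S"
      using t(2) by (auto simp: subset_image_inj)
    have "finite S" using t(1) S finite_imageD by blast
    let ?S = "{i \<in> S. u (v i) \<noteq> 0}"
    have "(\<Sum>i\<in>?S. u (v i) *\<^sub>R v i) = (\<Sum>i\<in>S. u (v i) *\<^sub>R v i)"
      using \<open>finite S\<close> by (intro sum.mono_neutral_left) auto
    also have "\<dots> = 0"
      using t(3) S by (simp add: sum.reindex)
    finally have "(\<Sum>i\<in>?S. u (v i) *\<^sub>R v i) = 0" .
    moreover have "?S \<noteq> {}"
      using t(4) S(3) by blast
    then have "(\<Sum>i\<in>?S. u (v i) *\<^sub>R v i) \<noteq> 0"
      using \<open>finite S\<close> S(1) by (intro nz[of ?S "\<lambda>i. u (v i)"]) auto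
    ultimately show False by blast
  qed
qed

lemma subalgebra_hull: "subalgebra (subalgebra hull B)"
  by (rule hull_in) (auto simp: subalgebra_def intro: subspace_Inter)

lemma subalgebra_span:
  fixes B :: "'a::real_algebra set"
  assumes "\<And>f g. f \<in> B \<Longrightarrow> g \<in> B \<Longrightarrow> f * g \<in> B"
  shows "subalgebra (span B)"
proof -
  have left: "subspace {g. f * g \<in> span B}" and right: "subspace {g. g * f \<in> span B}" for f
    by (rule subspaceI; simp add: distrib_left distrib_right span_add span_scale span_zero)+
  have step: "f * g \<in> span B" if "f \<in> B" "g \<in> span B" for f g
    using span_induct[OF that(2) left[of f]] assms[OF that(1)] span_base by blast
  have "f * g \<in> span B" if "f \<in> span B" "g \<in> span B" for f g
    using span_induct[OF that(1) right[of g]] step[OF _ that(2)] by blast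
  then show ?thesis
    by (simp add: subalgebra_def)
qed

lemma power_product_add:
  fixes f :: "'i \<Rightarrow> 'a::comm_monoid_mult"
  shows "power_product f (m + m') = power_product f m * power_product f m'"
proof -
  let ?K = "Poly_Mapping.keys m \<union> Poly_Mapping.keys m'"
  have *: "power_product f p = (\<Prod>i\<in>?K. f i ^ Poly_Mapping.lookup p i)" if "Poly_Mapping.keys p \<subseteq> ?K" for p
    unfolding power_product_def using that by (intro prod.mono_neutral_left) (auto simp: in_keys_iff)
  show ?thesis
    using keys_add[of m m'] by (simp add: * lookup_add power_add prod.distrib)
qed

lemma power_product_single: "power_product f (Poly_Mapping.single i 1) = f i"
  by (simp add: power_product_def)

lemma power_product_mem_subalgebra:
  fixes f :: "'i \<Rightarrow> 'a::{real_algebra_1,comm_ring_1}"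
  assumes "subalgebra N" "m \<noteq> 0" "\<And>i. i \<in> Poly_Mapping.keys m \<Longrightarrow> f i \<in> N"
  shows "power_product f m \<in> N"
proof -
  have mult: "f * g \<in> N" if "f \<in> N" "g \<in> N" for f g
    using assms(1) that by (simp add: subalgebra_def)
  have pow: "g ^ Suc l \<in> N" if "g \<in> N" for g l
    by (induction l) (use that mult in auto)
  have prod: "prod h K \<in> N" if "finite K" "K \<noteq> {}" "\<And>i. i \<in> K \<Longrightarrow> h i \<in> N" for h and K :: "'i set"
    using that by (induction rule: finite_ne_induct) (auto intro: mult)
  have "f i ^ Poly_Mapping.lookup m i \<in> N" if "i \<in> Poly_Mapping.keys m" for i
  proof -
    have "Poly_Mapping.lookup m i \<noteq> 0"
      using that by (simp add: in_keys_iff)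
    then obtain l where l: "Poly_Mapping.lookup m i = Suc l"
      using not0_implies_Suc by blast
    show ?thesis unfolding l by (rule pow[OF assms(3)[OF that]])
  qed
  moreover have "Poly_Mapping.keys m \<noteq> {}"
    using assms(2) by simp
  ultimately show ?thesis
    unfolding power_product_def by (intro prod) simp_all
qed

text \<open>The nonconstant power products are closed under multiplication, so their span is already the
  algebra generated.\<close>

lemma hull_subset_span_power_products:
  fixes f :: "'i \<Rightarrow> 'a::{real_algebra_1,comm_ring_1}"
  shows "subalgebra (span (power_product f ` {m. m \<noteq> 0 \<and> Poly_Mapping.keys m \<subseteq> J}))" (is "subalgebra (span ?P)")
    and "subalgebra hull (f ` J) \<subseteq> span (power_product f ` {m. m \<noteq> 0 \<and> Poly_Mapping.keys m \<subseteq> J})"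
proof -
  show sub: "subalgebra (span ?P)"
  proof (rule subalgebra_span)
    fix g h assume "g \<in> ?P" "h \<in> ?P"
    then obtain m m' where m: "g = power_product f m" "m \<noteq> 0" "Poly_Mapping.keys m \<subseteq> J"
      "h = power_product f m'" "m' \<noteq> 0" "Poly_Mapping.keys m' \<subseteq> J"
      by blast
    have "m + m' \<noteq> 0"
    proof
      assume "m + m' = 0"
      then have "Poly_Mapping.lookup m i + Poly_Mapping.lookup m' i = 0" for i
        by (metis lookup_add lookup_zero)
      then show False using \<open>m \<noteq> 0\<close> by (auto intro: poly_mapping_eqI)
    qed
    moreover have "Poly_Mapping.keys (m + m') \<subseteq> J"
      using keys_add[of m m'] m by blast
    ultimately show "g * h \<in> ?P"
      using m by (auto simp: power_product_add[symmetric])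
  qed
  show "subalgebra hull (f ` J) \<subseteq> span ?P"
  proof (rule hull_minimal)
    show "subalgebra (span ?P)" by (rule sub)
    show "f ` J \<subseteq> span ?P"
    proof
      fix g assume "g \<in> f ` J"
      then obtain i where i: "i \<in> J" "g = f i" by blast
      have "Poly_Mapping.single i (1::nat) \<noteq> 0"
        by (metis keys_single keys_zero empty_not_insert zero_neq_one)
      then have "power_product f (Poly_Mapping.single i 1) \<in> ?P"
        using i(1) by (intro imageI) auto
      then show "g \<in> span ?P"
        unfolding i(2) power_product_single by (rule span_base)
    qed
  qed
qed

section \<open>The free algebra\<close>

lemma zero_notin_A0: "0 \<notin> A0 \<alpha>"
  using not_has_growth_0 by (simp add: A0_def)

context growth_bound
begin

lemma combination_A0:
  assumes "finite S" "S \<noteq> {}" "0 \<notin> S" "\<And>m. m \<in> S \<Longrightarrow> c m \<noteq> 0"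
    and "inj_on A (\<Union>m\<in>S. Poly_Mapping.keys m)"
  shows "combination A S c \<in> A0 \<alpha>"
proof (rule tame_A0)
  show "tame (combination A S c)"
    using assms by (intro tame_combination)
  show "has_growth \<alpha> (combination A S c n)" for n
    using assms by (intro has_growth_combination[of S c "\<Union>m\<in>S. Poly_Mapping.keys m"]) auto
qed

text \<open>Every nonzero element of the algebra is a combination of power products with nonzero coefficients,
  and such combinations have the required growth.\<close>

lemma span_power_products_A0:
  assumes "F \<in> span (power_product gen ` {m. m \<noteq> 0 \<and> Poly_Mapping.keys m \<subseteq> J})" "F \<noteq> 0"
  shows "F \<in> A0 \<alpha>"
proof -
  obtain S c where S: "finite S" "S \<subseteq> {m. m \<noteq> 0 \<and> Poly_Mapping.keys m \<subseteq> J}"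
    "F = (\<Sum>m\<in>S. c m *\<^sub>R power_product gen m)" "\<forall>m\<in>S. c m \<noteq> 0"
    using assms(1) by (rule span_image_explicit)
  have "S \<noteq> {}"
    using S(3) assms(2) by auto
  then have "combination (\<lambda>B. B) S c \<in> A0 \<alpha>"
    using S by (intro combination_A0) (auto simp: inj_on_def)
  then show ?thesis
    using S(3) by (simp add: combination_def)
qed

definition free_part :: "(nat \<Rightarrow> real \<Rightarrow> real) set" where
  "free_part = subalgebra hull (range gen)"

lemma free_part_A0: "free_part - {0} \<subseteq> A0 \<alpha>"
proof
  fix F assume "F \<in> free_part - {0}"
  then have "F \<in> span (power_product gen ` {m. m \<noteq> 0 \<and> Poly_Mapping.keys m \<subseteq> UNIV})" "F \<noteq> 0"
    using hull_subset_span_power_products(2)[of gen UNIV] by (auto simp: free_part_def)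
  then show "F \<in> A0 \<alpha>" by (rule span_power_products_A0)
qed

text \<open>Evaluating a nonzero polynomial at distinct generators gives such a combination as well, now with
  power products indexed by the variables; it is nonzero because the zero sequence has no growth.\<close>

lemma freely_generates_free_part: "freely_generates (range gen) free_part"
  unfolding freely_generates_def
proof (intro conjI allI ballI impI)
  show "subalgebra hull (range gen) = free_part"
    by (simp add: free_part_def)
  fix s and f :: "nat \<Rightarrow> nat \<Rightarrow> real \<Rightarrow> real" and P
  assume P: "P \<in> polynomials_without_constant_term s"
    and *: "P \<noteq> 0 \<and> inj_on f {..<s} \<and> f ` {..<s} \<subseteq> range gen"
  have keys: "Poly_Mapping.keys m \<subseteq> {..<s}" if "m \<in> Poly_Mapping.keys P" for m
    using P that by (simp add: polynomials_without_constant_term_def)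
  have no_const: "0 \<notin> Poly_Mapping.keys P"
    using P by (simp add: polynomials_without_constant_term_def in_keys_iff)
  have "\<forall>i\<in>{..<s}. \<exists>B. f i = gen B"
    using * by blast
  from bchoice[OF this] obtain A where A: "\<forall>i\<in>{..<s}. f i = gen (A i)"
    by blast
  have "inj_on (gen \<circ> A) {..<s}"
    using inj_on_cong[of "{..<s}" f "gen \<circ> A"] * A by simp
  then have inj: "inj_on A {..<s}"
    by (rule inj_on_imageI2)
  have pp: "power_product f m = power_product (\<lambda>i. gen (A i)) m" if "m \<in> Poly_Mapping.keys P" for m
    unfolding power_product_def using keys[OF that] A by (intro prod.cong) auto
  have eval: "evaluate P f = (\<Sum>m\<in>Poly_Mapping.keys P. Poly_Mapping.lookup P m *\<^sub>R power_product f m)"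
    by (simp add: evaluate_def power_product_def)
  have "combination A (Poly_Mapping.keys P) (Poly_Mapping.lookup P) \<in> A0 \<alpha>"
  proof (rule combination_A0)
    show "inj_on A (\<Union>m\<in>Poly_Mapping.keys P. Poly_Mapping.keys m)"
      by (rule inj_on_subset[OF inj]) (use keys in blast)
  qed (use * no_const in \<open>auto simp: in_keys_iff\<close>)
  then have "evaluate P f \<in> A0 \<alpha>"
    by (simp add: eval combination_def pp)
  then have "evaluate P f \<noteq> 0"
    using zero_notin_A0 by metis
  moreover have "evaluate P f \<in> free_part"
  proof -
    have sub: "subalgebra free_part"
      unfolding free_part_def by (rule subalgebra_hull)
    have "f i \<in> free_part" if "i < s" for i
      using * that unfolding free_part_def by (auto intro!: hull_inc)
    then have "power_product f m \<in> free_part" if "m \<in> Poly_Mapping.keys P" for m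
      using keys[OF that] no_const that by (intro power_product_mem_subalgebra[OF sub]) auto
    then show ?thesis
      unfolding eval using sub
      by (intro subspace_sum subspace_scale) (auto simp: subalgebra_def)
  qed
  ultimately show "evaluate P f \<in> free_part - {0}" by blast
qed

text \<open>Finitely many elements involve only finitely many generators.  If they generated the algebra, a
  further generator would be a combination of power products not involving it; the difference would
  be a nontrivial combination equal to 0.\<close>

lemma infinitely_generated_free_part: "infinitely_generated free_part"
  unfolding infinitely_generated_def
proof (intro allI impI notI)
  fix G assume G: "subalgebra hull G = free_part" "finite G"
  let ?V = "\<lambda>J. span (power_product gen ` {m. m \<noteq> 0 \<and> Poly_Mapping.keys m \<subseteq> J})"
  have "\<forall>g\<in>G. \<exists>J. finite J \<and> g \<in> ?V J"
  proof
    fix g assume "g \<in> G"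
    have "g \<in> ?V UNIV"
      using subsetD[OF hull_subset_span_power_products(2)[of gen UNIV], of g]
        hull_inc[OF \<open>g \<in> G\<close>, of subalgebra] unfolding G(1) free_part_def .
    then obtain S c where S: "finite S" "S \<subseteq> {m. m \<noteq> 0 \<and> Poly_Mapping.keys m \<subseteq> UNIV}"
      "g = (\<Sum>m\<in>S. c m *\<^sub>R power_product gen m)" "\<forall>m\<in>S. c m \<noteq> 0"
      by (rule span_image_explicit)
    have "g \<in> ?V (\<Union>m\<in>S. Poly_Mapping.keys m)"
      unfolding S(3) using S(2) by (intro span_sum span_scale span_base imageI) auto
    moreover have "finite (\<Union>m\<in>S. Poly_Mapping.keys m)"
      using S(1) by simp
    ultimately show "\<exists>J. finite J \<and> g \<in> ?V J" by blast
  qed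
  from bchoice[OF this] obtain J where J: "\<forall>g\<in>G. finite (J g) \<and> g \<in> ?V (J g)"
    by blast
  define K where "K = (\<Union>g\<in>G. J g)"
  have "finite K"
    using G(2) J by (simp add: K_def)
  have "G \<subseteq> ?V K"
  proof
    fix g assume "g \<in> G"
    then have "?V (J g) \<subseteq> ?V K"
      by (intro span_mono image_mono) (auto simp: K_def)
    then show "g \<in> ?V K" using J \<open>g \<in> G\<close> by blast
  qed
  then have "free_part \<subseteq> ?V K"
    unfolding G(1)[symmetric] by (intro hull_minimal[where S = subalgebra] hull_subset_span_power_products(1))
  obtain B where "B \<notin> K"
    using ex_new_if_finite[OF _ \<open>finite K\<close>] by (auto simp: Finite_Set.finite_set)
  have "gen B \<in> ?V K"
    using subsetD[OF \<open>free_part \<subseteq> ?V K\<close>] hull_inc[of "gen B" "range gen" subalgebra]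
    by (simp add: free_part_def)
  then obtain S c where S: "finite S" "S \<subseteq> {m. m \<noteq> 0 \<and> Poly_Mapping.keys m \<subseteq> K}"
    "gen B = (\<Sum>m\<in>S. c m *\<^sub>R power_product gen m)" "\<forall>m\<in>S. c m \<noteq> 0"
    by (rule span_image_explicit)
  define b :: "nat set \<Rightarrow>\<^sub>0 nat" where "b = Poly_Mapping.single B 1"
  have b: "Poly_Mapping.keys b = {B}"
    by (simp add: b_def)
  then have "b \<notin> S" "b \<noteq> 0"
    using S(2) \<open>B \<notin> K\<close> by auto
  let ?c = "\<lambda>m. if m = b then - 1 else c m"
  have "combination (\<lambda>B. B) (insert b S) ?c = - gen B + (\<Sum>m\<in>S. ?c m *\<^sub>R power_product gen m)"
    using S(1) \<open>b \<notin> S\<close> by (simp add: combination_def b_def power_product_single[unfolded One_nat_def])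
  also have "(\<Sum>m\<in>S. ?c m *\<^sub>R power_product gen m) = gen B"
    unfolding S(3) using \<open>b \<notin> S\<close> by (intro sum.cong) auto
  finally have "combination (\<lambda>B. B) (insert b S) ?c = 0"
    by (simp only: left_minus)
  moreover have "combination (\<lambda>B. B) (insert b S) ?c \<in> A0 \<alpha>"
    using S \<open>b \<noteq> 0\<close> by (intro combination_A0) (auto simp: inj_on_def)
  ultimately show False
    using zero_notin_A0 by metis
qed

section \<open>Truncations are dense\<close>

lemma truncated_c0_X: "truncated G \<Longrightarrow> G \<in> c0_X"
  using tame_c0_X[OF tame_add_truncated[of 0 G]] tame_combination[of "{}" "\<lambda>B. B"]
  by (simp add: combination_def)

text \<open>Keep the members with index at most \<open>j\<close> and multiply them by a cutoff function that equals 1 up to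
  \<open>j\<close> and vanishes from \<open>j + 1\<close> on.\<close>

lemma truncated_approximation:
  assumes F: "F \<in> c0_X" and "0 < \<delta>"
  obtains G where "truncated G" "\<forall>n. gauge_X (F n - G n) \<le> \<delta>"
proof -
  define cut where "cut j x = max 0 (min 1 (real j + 1 - x))" for j x
  define T where "T j n = (if n \<le> j then (\<lambda>x. cut j x * F n x) else 0)" for j n
  have cut: "0 \<le> cut j x" "cut j x \<le> 1" for j x
    by (auto simp: cut_def)
  have F_C: "F n \<in> C_halfline" for n
    using F by (simp add: c0_X_iff X_space_iff)
  have T_C: "T j n \<in> C_halfline" for j n
  proof (cases "n \<le> j")
    case True
    have "continuous_on {0..} (\<lambda>x. cut j x * F n x)"
      unfolding cut_def using F_C by (intro continuous_intros) (auto simp: C_halfline_def)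
    then show ?thesis
      using True F_C by (auto simp: T_def C_halfline_def)
  qed (simp add: T_def subspace_0[OF subspace_C_halfline])
  have "\<forall>\<^sub>F j in sequentially. \<forall>n. gauge_X (F n - T j n) \<le> \<delta>"
  proof (rule damped_uniformly_small[OF F _ _ _ \<open>0 < \<delta>\<close>])
    show "F n - T j n \<in> C_halfline" for j n
      by (intro subspace_diff[OF subspace_C_halfline] F_C T_C)
    have T_eq: "F n x - T j n x = (if n \<le> j then (1 - cut j x) * F n x else F n x)" for j n x
      by (simp add: T_def left_diff_distrib)
    show "\<bar>(F n - T j n) x\<bar> \<le> \<bar>F n x\<bar>" for j n x
      using cut[of j x] by (auto simp: diff_fun_apply T_eq abs_mult intro!: mult_left_le_one_le)
    show "\<bar>(F n - T j n) x\<bar> \<le> \<bar>F n x\<bar> / real (Suc j)" if "n \<le> j" "x \<le> real j" for j n x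
    proof -
      have "cut j x = 1" using that by (simp add: cut_def)
      then show ?thesis using that by (simp add: diff_fun_apply T_def)
    qed
  qed
  then obtain j where j: "\<forall>n. gauge_X (F n - T j n) \<le> \<delta>"
    by (auto simp: eventually_sequentially)
  have "T j n x = 0" if "Suc j \<le> n \<or> real (Suc j) \<le> x" for n x
    using that by (auto simp: T_def cut_def)
  then have "truncated (T j)"
    unfolding truncated_def using T_C by blast
  then show thesis
    using j that by blast
qed

lemma small_multiple:
  assumes F: "F \<in> c0_X" and "0 < \<delta>"
  shows "\<exists>e. e \<noteq> 0 \<and> (\<forall>n. gauge_X ((- e) *\<^sub>R F n) \<le> \<delta>)"
proof -
  have F_C: "F n \<in> C_halfline" for n
    using F by (simp add: c0_X_iff X_space_iff)
  have abs_eq: "\<bar>(- (1 / real (Suc j)) *\<^sub>R F n) x\<bar> = \<bar>F n x\<bar> / real (Suc j)" for j n x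
    by (simp add: abs_mult abs_divide)
  have "\<forall>\<^sub>F j in sequentially. \<forall>n. gauge_X ((- (1 / real (Suc j))) *\<^sub>R F n) \<le> \<delta>"
  proof (rule damped_uniformly_small[OF F _ _ _ \<open>0 < \<delta>\<close>])
    show "(- (1 / real (Suc j))) *\<^sub>R F n \<in> C_halfline" for j n
      by (intro subspace_scale[OF subspace_C_halfline] F_C)
    have "\<bar>F n x\<bar> * 1 \<le> \<bar>F n x\<bar> * real (Suc j)" for j n x
      by (intro mult_left_mono) auto
    then show "\<bar>((- (1 / real (Suc j))) *\<^sub>R F n) x\<bar> \<le> \<bar>F n x\<bar>" for j n x
      unfolding abs_eq by (simp add: pos_divide_le_eq del: of_nat_Suc)
    show "\<bar>((- (1 / real (Suc j))) *\<^sub>R F n) x\<bar> \<le> \<bar>F n x\<bar> / real (Suc j)" for j n x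
      unfolding abs_eq by simp
  qed
  then obtain j where "\<forall>n. gauge_X ((- (1 / real (Suc j))) *\<^sub>R F n) \<le> \<delta>"
    by (auto simp: eventually_sequentially)
  then show ?thesis
    by (intro exI[of _ "1 / real (Suc j)"]) auto
qed

end

section \<open>Cardinality\<close>

text \<open>A continuous function is determined by its values at rational points, hence by the rational points
  below its graph.  This embeds \<open>c0_X\<close> into the sets of natural numbers.  The extra number \<open>j\<close> is
  coded along with the function because the dense subspace below has one generator for each
  truncated sequence and each degree of accuracy; it can be read off since the subgraph is never
  empty.\<close>

definition subgraph_code :: "(nat \<Rightarrow> real \<Rightarrow> real) \<times> nat \<Rightarrow> nat set" where
  "subgraph_code p =
     to_nat ` {(j, n, q, r). j = snd p \<and> real_of_rat r < fst p n (real_of_rat q)}"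

lemma C_halfline_eqI:
  assumes "f \<in> C_halfline" "g \<in> C_halfline" "\<And>q. f (real_of_rat q) = g (real_of_rat q)"
  shows "f = g"
proof (rule ext, rule ccontr)
  fix x assume neq: "f x \<noteq> g x"
  have "0 \<le> x"
  proof (rule ccontr)
    assume "\<not> 0 \<le> x"
    then have "f x = 0" "g x = 0"
      using assms(1,2) by (simp_all add: C_halfline_def)
    then show False using neq by simp
  qed
  have "continuous_on {0..} (\<lambda>x. f x - g x)"
    using assms(1,2) by (intro continuous_intros) (auto simp: C_halfline_def)
  then obtain d where d: "0 < d" "\<And>y. 0 \<le> y \<Longrightarrow> dist y x < d \<Longrightarrow>
      dist (f y - g y) (f x - g x) < \<bar>f x - g x\<bar>"
    using \<open>0 \<le> x\<close> neq unfolding continuous_on_iff by (metis atLeast_iff eq_iff_diff_eq_0 zero_less_abs_iff)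
  obtain q where q: "x < real_of_rat q" "real_of_rat q < x + d"
    using of_rat_dense[of x "x + d"] d(1) by auto
  then have "dist (f (real_of_rat q) - g (real_of_rat q)) (f x - g x) < \<bar>f x - g x\<bar>"
    using \<open>0 \<le> x\<close> by (intro d(2)) (linarith, simp add: dist_real_def)
  then show False
    using assms(3)[of q] by (simp add: dist_real_def)
qed

lemma inj_on_subgraph_code: "inj_on subgraph_code (c0_X \<times> UNIV)"
proof (rule inj_onI, clarsimp simp: prod_eq_iff)
  fix F G i j assume FG: "F \<in> c0_X" "G \<in> c0_X" "subgraph_code (F, i) = subgraph_code (G, j)"
  then have "{(l, n, q, r). l = i \<and> real_of_rat r < F n (real_of_rat q)}
     = {(l, n, q, r). l = j \<and> real_of_rat r < G n (real_of_rat q)}"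
    unfolding subgraph_code_def by (subst (asm) inj_image_eq_iff) auto
  then have eq: "l = i \<and> real_of_rat r < F n (real_of_rat q) \<longleftrightarrow>
      l = j \<and> real_of_rat r < G n (real_of_rat q)" for l n q r
    unfolding set_eq_iff by (auto dest!: spec[of _ "(l, n, q, r)"])
  obtain r where "real_of_rat r < F 0 (real_of_rat 0)"
    using of_rat_dense[of "F 0 (real_of_rat 0) - 1" "F 0 (real_of_rat 0)"] by auto
  with eq[of i r 0 0] have "i = j" by simp
  have "F n (real_of_rat q) = G n (real_of_rat q)" for n q
  proof (rule ccontr)
    assume "F n (real_of_rat q) \<noteq> G n (real_of_rat q)"
    then consider "F n (real_of_rat q) < G n (real_of_rat q)" | "G n (real_of_rat q) < F n (real_of_rat q)"
      by linarith
    then show False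
    proof cases
      case 1
      then obtain r where "F n (real_of_rat q) < real_of_rat r" "real_of_rat r < G n (real_of_rat q)"
        using of_rat_dense by blast
      then show False using eq[of i r n q] \<open>i = j\<close> by simp
    next
      case 2
      then obtain r where "G n (real_of_rat q) < real_of_rat r" "real_of_rat r < F n (real_of_rat q)"
        using of_rat_dense by blast
      then show False using eq[of i r n q] \<open>i = j\<close> by simp
    qed
  qed
  then have "F n = G n" for n
    using FG by (intro C_halfline_eqI) (auto simp: c0_X_iff X_space_iff)
  then show "F = G \<and> i = j"
    using \<open>i = j\<close> by blast
qed

lemma c0_X_times_nat_lepoll: "c0_X \<times> (UNIV :: nat set) \<lesssim> (UNIV :: nat set set)"
  unfolding lepoll_def using inj_on_subgraph_code by blast

lemma c0_X_lepoll: "c0_X \<lesssim> (UNIV :: nat set set)"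
proof -
  have "inj_on (\<lambda>F. (F, 0::nat)) c0_X"
    by (simp add: inj_on_def)
  then have "c0_X \<lesssim> c0_X \<times> (UNIV :: nat set)"
    unfolding lepoll_def by auto
  then show ?thesis
    using c0_X_times_nat_lepoll by (rule lepoll_trans)
qed

section \<open>The dense subspace\<close>

context growth_bound
begin

text \<open>Generators are power products with a single exponent 1, and the truncated summand is harmless.\<close>

lemma perturbed_generators_A0:
  assumes "finite S" "S \<noteq> {}" "\<And>B. B \<in> S \<Longrightarrow> d B \<noteq> 0" "truncated G"
  shows "G + (\<Sum>B\<in>S. d B *\<^sub>R gen B) \<in> A0 \<alpha>"
proof -
  let ?s = "\<lambda>B. Poly_Mapping.single B (1::nat)"
  have inj: "inj ?s"
  proof (rule injI)
    fix B B' assume "?s B = ?s B'"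
    then have "Poly_Mapping.keys (?s B) = Poly_Mapping.keys (?s B')" by (rule arg_cong)
    then show "B = B'" by simp
  qed
  define c where "c m = d (inv ?s m)" for m
  have c: "c (?s B) = d B" for B
    unfolding c_def inv_f_f[OF inj] ..
  let ?H = "combination (\<lambda>B. B) (?s ` S) c"
  have "?H = (\<Sum>B\<in>S. d B *\<^sub>R gen B)"
    unfolding combination_def sum.reindex[OF inj_on_subset[OF inj subset_UNIV]] by (simp only: o_def c power_product_single)
  moreover have nz: "0 \<notin> ?s ` S"
    by (auto simp: poly_mapping_eq_iff fun_eq_iff lookup_single when_def split: if_splits)
  have "tame (?H + G)"
    using assms nz by (intro tame_add_truncated tame_combination) auto
  moreover have "has_growth \<alpha> ((?H + G) n)" for n
    unfolding has_growth_add_truncated[OF \<open>truncated G\<close>] using assms nz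
    by (intro has_growth_combination[of _ _ S]) (auto simp: c[simplified])
  ultimately show ?thesis
    using tame_A0[of "?H + G"] by (simp add: add.commute)
qed

text \<open>For every truncated sequence and every accuracy there is an index set whose vector \<open>v\<close> is the
  truncated sequence plus a tiny nonzero multiple of the generator with that index; this is possible
  because there are no more such pairs than index sets.  The span of the vectors is dense, as the
  truncated sequences are, and a nontrivial combination of them differs by a truncated sequence from
  a nontrivial combination of generators.  In particular the vectors are linearly independent, so
  they are a basis of the span indexed by all sets of natural numbers.  Extending it to a basis of
  \<open>c0_X\<close> cannot increase the cardinality, since \<open>c0_X\<close> itself has no more elements than there are
  sets of natural numbers.\<close>

lemma maximal_dense_lineable:
  "\<exists>M. subspace M \<and> M \<subseteq> c0_X \<and> (\<forall>F\<in>c0_X. \<forall>\<epsilon>>0. \<exists>G\<in>M. d_c0 F G < \<epsilon>) \<and>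
     same_dimension M c0_X \<and> M - {0} \<subseteq> A0 \<alpha>"
proof -
  have gen_c0: "gen B \<in> c0_X" for B
  proof -
    have "tame (combination (\<lambda>B. B) {Poly_Mapping.single B 1} (\<lambda>_. 1))"
      by (rule tame_combination) (auto simp: poly_mapping_eq_iff fun_eq_iff lookup_single when_def)
    then show ?thesis
      using tame_c0_X by (simp add: combination_def power_product_single[unfolded One_nat_def])
  qed
  have "Collect truncated \<times> (UNIV :: nat set) \<lesssim> (UNIV :: nat set set)"
    using truncated_c0_X
    by (intro lepoll_trans[OF subset_imp_lepoll c0_X_times_nat_lepoll]) auto
  then obtain \<phi> where \<phi>: "Collect truncated \<times> (UNIV :: nat set) \<subseteq> \<phi> ` (UNIV :: nat set set)"
    unfolding lepoll_iff by blast
  \<comment> \<open>the value 0 is used for the index sets that \<open>\<phi>\<close> does not send to a truncated sequence\<close>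
  define g where "g B = (if truncated (fst (\<phi> B)) then fst (\<phi> B) else 0)" for B
  have "\<exists>e. e \<noteq> 0 \<and> (\<forall>n. gauge_X ((- e) *\<^sub>R gen B n) \<le> 1 / real (Suc (snd (\<phi> B))))" for B
    by (rule small_multiple[OF gen_c0]) simp
  then obtain e where e: "e B \<noteq> 0" "gauge_X ((- e B) *\<^sub>R gen B n) \<le> 1 / real (Suc (snd (\<phi> B)))" for B n
    by metis
  have g: "truncated (g B)" for B
    using subspace_0[OF subspace_truncated] by (simp add: g_def)
  define v where "v B = g B + e B *\<^sub>R gen B" for B
  define M where "M = span (range v)"
  have v_c0: "v B \<in> c0_X" for B
    unfolding v_def
    by (intro subspace_add[OF subspace_c0_X] subspace_scale[OF subspace_c0_X] gen_c0 truncated_c0_X g)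
  have M_c0: "M \<subseteq> c0_X"
    unfolding M_def using v_c0 by (intro span_minimal subspace_c0_X) auto
  have comb: "(\<Sum>B\<in>S. c B *\<^sub>R v B) \<in> A0 \<alpha>"
    if "finite S" "S \<noteq> {}" "\<And>B. B \<in> S \<Longrightarrow> c B \<noteq> 0" for S c
  proof -
    have "(\<Sum>B\<in>S. c B *\<^sub>R g B) \<in> Collect truncated"
      using g by (intro subspace_sum[OF subspace_truncated] subspace_scale[OF subspace_truncated]) auto
    then have "(\<Sum>B\<in>S. c B *\<^sub>R g B) + (\<Sum>B\<in>S. (c B * e B) *\<^sub>R gen B) \<in> A0 \<alpha>"
      using that e(1) by (intro perturbed_generators_A0) auto
    then show ?thesis
      by (simp add: v_def scaleR_add_right sum.distrib)
  qed
  have M_A0: "M - {0} \<subseteq> A0 \<alpha>"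
  proof
    fix F assume "F \<in> M - {0}"
    then have "F \<in> span (range v)" "F \<noteq> 0" by (simp_all add: M_def)
    from this(1) obtain S c where S: "finite S" "S \<subseteq> UNIV" "F = (\<Sum>B\<in>S. c B *\<^sub>R v B)" "\<forall>B\<in>S. c B \<noteq> 0"
      by (rule span_image_explicit)
    have "S \<noteq> {}" using S(3) \<open>F \<noteq> 0\<close> by auto
    then show "F \<in> A0 \<alpha>"
      unfolding S(3) using S(1,4) by (intro comb) auto
  qed
  have M_dense: "\<exists>G\<in>M. d_c0 F G < \<epsilon>" if "F \<in> c0_X" "0 < \<epsilon>" for F \<epsilon>
  proof -
    obtain G where G: "truncated G" "\<forall>n. gauge_X (F n - G n) \<le> \<epsilon> / 3"
      using truncated_approximation[OF \<open>F \<in> c0_X\<close>, of "\<epsilon> / 3"] \<open>0 < \<epsilon>\<close> by auto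
    obtain j where j: "1 / real (Suc j) < \<epsilon> / 3"
      using nat_approx_posE[of "\<epsilon> / 3"] \<open>0 < \<epsilon>\<close> by auto
    obtain B where B: "\<phi> B = (G, j)"
      using \<phi> G(1) by (metis (no_types, lifting) SigmaI UNIV_I imageE mem_Collect_eq subsetD)
    have "d_X (F n) (v B n) \<le> 2 * \<epsilon> / 3" for n
    proof -
      have "F n - v B n = (F n - G n) + (- e B) *\<^sub>R gen B n"
        using G(1) by (simp add: v_def g_def B)
      moreover have "F n - G n \<in> X_space" "(- e B) *\<^sub>R gen B n \<in> X_space"
        using \<open>F \<in> c0_X\<close> truncated_c0_X[OF G(1)] gen_c0[of B] unfolding c0_X_iff
        by (blast intro: subspace_diff[OF subspace_X_space] subspace_scale[OF subspace_X_space])+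
      ultimately have "d_X (F n) (v B n) \<le> gauge_X (F n - G n) + gauge_X ((- e B) *\<^sub>R gen B n)"
        unfolding d_X_eq using gauge_X_triangle by metis
      then show ?thesis
        using G(2)[rule_format, of n] e(2)[of B n] j by (simp add: B)
    qed
    then have "d_c0 F (v B) \<le> 2 * \<epsilon> / 3"
      unfolding d_c0_def by (intro cSUP_least) auto
    then have "d_c0 F (v B) < \<epsilon>"
      using \<open>0 < \<epsilon>\<close> by simp
    moreover have "v B \<in> M"
      unfolding M_def by (rule span_base) (rule rangeI)
    ultimately show ?thesis by blast
  qed
  have M_dim: "same_dimension M c0_X"
  proof -
    have nz: "(\<Sum>B\<in>S. c B *\<^sub>R v B) \<noteq> 0"
      if "finite S" "S \<noteq> {}" "S \<subseteq> UNIV" "\<forall>B\<in>S. c B \<noteq> 0" for S c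
    proof
      assume "(\<Sum>B\<in>S. c B *\<^sub>R v B) = 0"
      moreover have "(\<Sum>B\<in>S. c B *\<^sub>R v B) \<in> A0 \<alpha>"
        using that by (intro comb) auto
      ultimately show False
        by (simp only: zero_notin_A0)
    qed
    have ind: "inj v" "independent (range v)"
      by (rule independent_family[of UNIV v], rule nz, assumption+)+
    obtain C where C: "range v \<subseteq> C" "C \<subseteq> c0_X" "independent C" "c0_X \<subseteq> span C"
    proof (rule maximal_independent_subset_extend[OF _ ind(2)])
      show "range v \<subseteq> c0_X" using v_c0 by blast
    qed
    have "span C = c0_X"
      using C(4) span_minimal[OF C(2) subspace_c0_X] by (rule equalityI[rotated])
    moreover have "range v \<approx> C"
    proof (rule lepoll_antisym)
      show "range v \<lesssim> C"
        by (rule subset_imp_lepoll[OF C(1)])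
      have "C \<lesssim> (UNIV :: nat set set)"
        by (rule lepoll_trans[OF subset_imp_lepoll[OF C(2)] c0_X_lepoll])
      also have "(UNIV :: nat set set) \<approx> range v"
        by (rule eqpoll_sym[OF inj_on_image_eqpoll_self[OF ind(1)]])
      finally show "C \<lesssim> range v" .
    qed
    ultimately show ?thesis
      unfolding same_dimension_def M_def using ind(2) C(3) by blast
  qed
  have "subspace M"
    unfolding M_def by (rule subspace_span)
  then show ?thesis
    using M_c0 M_dense M_dim M_A0 by (intro exI[of _ M] conjI ballI allI impI)
qed

end

theorem theorem4p3:
  fixes \<alpha> :: "real \<Rightarrow> real"
  assumes "continuous_on {0..} \<alpha>"
    and "mono_on {0..} \<alpha>"
    and "\<And>x. x \<ge> 0 \<Longrightarrow> \<alpha> x \<ge> 1"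
  shows "(\<exists>M. subspace M \<and> M \<subseteq> c0_X \<and>
              (\<forall>F\<in>c0_X. \<forall>\<epsilon>>0. \<exists>G\<in>M. d_c0 F G < \<epsilon>) \<and>
              same_dimension M c0_X \<and>
              M - {0} \<subseteq> A0 \<alpha>) \<and>
         (\<exists>N. subalgebra N \<and> N \<subseteq> {F. \<forall>n. F n \<in> C_halfline} \<and>
              free_algebra N \<and> infinitely_generated N \<and>
              N - {0} \<subseteq> A0 \<alpha>)"
proof -
  interpret growth_bound \<alpha>
    by unfold_locales (use assms in auto)
  have "F n \<in> C_halfline" if "F \<in> free_part" for F n
  proof (cases "F = 0")
    case True
    then show ?thesis using subspace_0[OF subspace_C_halfline] by simp
  next
    case False
    then show ?thesis using free_part_A0 that by (auto simp: A0_def X_space_iff)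
  qed
  then have "free_part \<subseteq> {F. \<forall>n. F n \<in> C_halfline}"
    by blast
  moreover have "subalgebra free_part"
    unfolding free_part_def by (rule subalgebra_hull)
  moreover have "free_algebra free_part"
    unfolding free_algebra_def using freely_generates_free_part by (rule exI)
  ultimately show ?thesis
    using infinitely_generated_free_part free_part_A0
    by (intro conjI[OF maximal_dense_lineable] exI[of _ free_part] conjI)
qed

end
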